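(* Let $q\ge 3$ be odd, $d\ge 2$, and let $\sigma$ be a non-degenerate quadratic form on $\mathbb{F}_q^n$ defining a polar space of type $O(2d+1,q)$ (with $n=2d+1$), $O^+(2d,q)$ or $O^-(2d,q)$ (with $n=2d$); let $\perp$ be the associated polarity. Let $V_+$ (resp. $V_-$) be the set of points $\langle v\rangle$ with $\sigma(v)$ a nonzero square (resp. a non-square) in $\mathbb{F}_q$, fix $\epsilon\in\{+,-\}$, and let $\Gamma_\epsilon$ be the graph with vertex set $V_\epsilon$, two points $x,y$ adjacent iff $x\subseteq y^\perp$. Let $3\le m\le d$ and let $L_1,L_2$ be $(m-1)$-dimensional subspaces, not totally isotropic, such that $p:=L_1\cap L_2$ has dimension $m-2$ and $p=L_1\cap L_1^\perp=L_2\cap L_2^\perp$; put $P=L_1+L_2$. Let $C_1$ be the set of points of $L_1$ not in $L_2$ and $C_2$ the set of points of $L_2$ not in $L_1$, and suppose all points of $C_1\cup C_2$ lie in $V_\epsilon$. Then: (i) $\{C_1,C_2\}$ is a switching set of $\Gamma_\epsilon$. (ii) Let $\delta=-$ if $q\equiv 3\pmod 4$ and $\delta=+$ if $q\equiv 1\pmod 4$. If $m=3$, $P/p$ with the induced form is isomorphic to $O^\delta(2,q)$, and $n\ge 7$, then the graph $\overline{\Gamma}_\epsilon$ obtained from $\Gamma_\epsilon$ by switching with respect to $\{C_1,C_2\}$ is not isomorphic to $\Gamma_\epsilon$.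
   Context: Points are $1$-dimensional subspaces. $O^+(2,q)$ (resp. $O^-(2,q)$) denotes a non-degenerate $2$-dimensional quadratic space containing (resp. not containing) nonzero singular vectors. For a vertex $x$, $\Gamma(x)$ is its neighbourhood. For disjoint vertex sets $C_1,C_2$ of a graph $\Gamma$ with $D$ the remaining vertices: $\{C_1,C_2\}$ is a switching set if $|C_1|=|C_2|$, the induced subgraphs on $C_1$, $C_2$, $C_1\cup C_2$ are regular with equal degrees on $C_1$ and $C_2$, and every $x\in D$ satisfies $|\Gamma(x)\cap C_1|=|\Gamma(x)\cap C_2|$ or $\Gamma(x)\cap(C_1\cup C_2)\in\{C_1,C_2\}$. The graph $\overline{\Gamma}$ obtained by switching has the same vertices, the same edges inside $C_1\cup C_2$ and inside $D$, and for $x\in D$: $\overline{\Gamma}(x)\cap(C_1\cup C_2)$ equals $C_1$ if $\Gamma(x)\cap(C_1\cup C_2)=C_2$, equals $C_2$ if $\Gamma(x)\cap(C_1\cup C_2)=C_1$, and equals $\Gamma(x)\cap(C_1\cup C_2)$ otherwise. *)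

theory Defs
  imports "HOL-Analysis.Analysis" "HOL-Library.Set_Algebras"
begin

subsection \<open>Quadratic forms\<close>

definition polar :: "('a::field ^ 'n \<Rightarrow> 'a) \<Rightarrow> 'a ^ 'n \<Rightarrow> 'a ^ 'n \<Rightarrow> 'a" where
  "polar \<sigma> u v = \<sigma> (u + v) - \<sigma> u - \<sigma> v"

definition quadratic_form :: "('a::field ^ 'n \<Rightarrow> 'a) \<Rightarrow> bool" where
  "quadratic_form \<sigma> \<longleftrightarrow>
     (\<forall>c v. \<sigma> (c *s v) = c\<^sup>2 * \<sigma> v) \<and>
     (\<forall>u. Vector_Spaces.linear (*s) (*) (\<lambda>v. polar \<sigma> u v)) \<and>
     (\<forall>v. Vector_Spaces.linear (*s) (*) (\<lambda>u. polar \<sigma> u v))"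

definition perp :: "('a::field ^ 'n \<Rightarrow> 'a) \<Rightarrow> ('a ^ 'n) set \<Rightarrow> ('a ^ 'n) set" where
  "perp \<sigma> S = {v. \<forall>s\<in>S. polar \<sigma> v s = 0}"

text \<open>Only used in odd characteristic, where a trivial radical of the polar form is the usual
  notion of non-degeneracy.\<close>

definition nondegenerate :: "('a::field ^ 'n \<Rightarrow> 'a) \<Rightarrow> bool" where
  "nondegenerate \<sigma> \<longleftrightarrow> perp \<sigma> UNIV = {0}"

definition totally_isotropic :: "('a::field ^ 'n \<Rightarrow> 'a) \<Rightarrow> ('a ^ 'n) set \<Rightarrow> bool" where
  "totally_isotropic \<sigma> S \<longleftrightarrow> S \<subseteq> perp \<sigma> S"

definition totally_singular :: "('a::field ^ 'n \<Rightarrow> 'a) \<Rightarrow> ('a ^ 'n) set \<Rightarrow> bool" where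
  "totally_singular \<sigma> S \<longleftrightarrow> (\<forall>v\<in>S. \<sigma> v = 0)"

definition witt_index :: "('a::field ^ 'n \<Rightarrow> 'a) \<Rightarrow> nat" where
  "witt_index \<sigma> = Max {vec.dim S | S. vec.subspace S \<and> totally_singular \<sigma> S}"

text \<open>The types \<open>O(2d+1,q)\<close>, \<open>O\<^sup>+(2d,q)\<close> and \<open>O\<^sup>-(2d,q)\<close>, where \<open>q\<close> is the order of the field.
  In odd dimension over a finite field of odd order the polar space is determined by the dimension;
  in even dimension the two types are told apart by the Witt index.\<close>

definition type_O_odd :: "nat \<Rightarrow> ('a::field ^ 'n \<Rightarrow> 'a) \<Rightarrow> bool" where
  "type_O_odd d \<sigma> \<longleftrightarrow> quadratic_form \<sigma> \<and> nondegenerate \<sigma> \<and>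
     CARD('n) = 2 * d + 1"

definition type_O_plus :: "nat \<Rightarrow> ('a::field ^ 'n \<Rightarrow> 'a) \<Rightarrow> bool" where
  "type_O_plus d \<sigma> \<longleftrightarrow> quadratic_form \<sigma> \<and> nondegenerate \<sigma> \<and>
     CARD('n) = 2 * d \<and> witt_index \<sigma> = d"

definition type_O_minus :: "nat \<Rightarrow> ('a::field ^ 'n \<Rightarrow> 'a) \<Rightarrow> bool" where
  "type_O_minus d \<sigma> \<longleftrightarrow> quadratic_form \<sigma> \<and> nondegenerate \<sigma> \<and>
     CARD('n) = 2 * d \<and> witt_index \<sigma> + 1 = d"

datatype sign = Pos | Neg

text \<open>A quadratic form on the plane making it an \<open>O\<^sup>+(2,q)\<close> or an \<open>O\<^sup>-(2,q)\<close>.\<close>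

definition type_O2 :: "sign \<Rightarrow> ('a::field ^ 2 \<Rightarrow> 'a) \<Rightarrow> bool" where
  "type_O2 s \<tau> \<longleftrightarrow> quadratic_form \<tau> \<and> nondegenerate \<tau> \<and>
     (case s of Pos \<Rightarrow> \<exists>v. v \<noteq> 0 \<and> \<tau> v = 0 | Neg \<Rightarrow> \<not> (\<exists>v. v \<noteq> 0 \<and> \<tau> v = 0))"

text \<open>The quotient \<open>P/p\<close> is the set of cosets \<open>v +o p\<close> with \<open>v\<close> in \<open>P\<close>; its operations and the
  induced form are those of representatives. The map \<open>\<phi>\<close> is a linear isometry from \<open>P/p\<close> onto
  the quadratic space given by \<open>\<tau>\<close>.\<close>

definition quotient_isometric ::
  "('a::field ^ 'n \<Rightarrow> 'a) \<Rightarrow> ('a ^ 'n) set \<Rightarrow> ('a ^ 'n) set \<Rightarrow> ('a ^ 'k \<Rightarrow> 'a) \<Rightarrow> bool" where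
  "quotient_isometric \<sigma> P p \<tau> \<longleftrightarrow>
     (\<exists>\<phi>. bij_betw \<phi> ((\<lambda>v. v +o p) ` P) UNIV \<and>
       (\<forall>u\<in>P. \<forall>v\<in>P. \<phi> ((u + v) +o p) = \<phi> (u +o p) + \<phi> (v +o p)) \<and>
       (\<forall>c. \<forall>v\<in>P. \<phi> ((c *s v) +o p) = c *s \<phi> (v +o p)) \<and>
       (\<forall>v\<in>P. \<tau> (\<phi> (v +o p)) = \<sigma> v))"

definition points :: "('a::field ^ 'n) set set" where
  "points = {x. vec.subspace x \<and> vec.dim x = 1}"

definition points_of_sign :: "('a::field ^ 'n \<Rightarrow> 'a) \<Rightarrow> sign \<Rightarrow> ('a ^ 'n) set set" where
  "points_of_sign \<sigma> \<epsilon> = (case \<epsilon> of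
      Pos \<Rightarrow> {vec.span {v} | v. \<sigma> v \<noteq> 0 \<and> (\<exists>a. \<sigma> v = a\<^sup>2)}
    | Neg \<Rightarrow> {vec.span {v} | v. \<not> (\<exists>a. \<sigma> v = a\<^sup>2)})"


subsection \<open>Graphs and switching\<close>

text \<open>Only the restriction of \<open>adj\<close> to \<open>verts\<close> is meaningful.\<close>

record 'v graph =
  verts :: "'v set"
  adj :: "'v \<Rightarrow> 'v \<Rightarrow> bool"

definition nbhd :: "'v graph \<Rightarrow> 'v \<Rightarrow> 'v set" where
  "nbhd G x = {y \<in> verts G. adj G x y}"

definition graph_iso :: "'v graph \<Rightarrow> 'w graph \<Rightarrow> bool" where
  "graph_iso G H \<longleftrightarrow> (\<exists>f. bij_betw f (verts G) (verts H) \<and>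
     (\<forall>x\<in>verts G. \<forall>y\<in>verts G. adj G x y \<longleftrightarrow> adj H (f x) (f y)))"

definition induced_regular :: "'v graph \<Rightarrow> 'v set \<Rightarrow> nat \<Rightarrow> bool" where
  "induced_regular G S k \<longleftrightarrow> (\<forall>x\<in>S. card (nbhd G x \<inter> S) = k)"

definition switching_set :: "'v graph \<Rightarrow> 'v set \<Rightarrow> 'v set \<Rightarrow> bool" where
  "switching_set G C\<^sub>1 C\<^sub>2 \<longleftrightarrow>
     finite (verts G) \<and> C\<^sub>1 \<subseteq> verts G \<and> C\<^sub>2 \<subseteq> verts G \<and> C\<^sub>1 \<inter> C\<^sub>2 = {} \<and>
     card C\<^sub>1 = card C\<^sub>2 \<and>
     (\<exists>k. induced_regular G C\<^sub>1 k \<and> induced_regular G C\<^sub>2 k) \<and>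
     (\<exists>l. induced_regular G (C\<^sub>1 \<union> C\<^sub>2) l) \<and>
     (\<forall>x \<in> verts G - (C\<^sub>1 \<union> C\<^sub>2).
        card (nbhd G x \<inter> C\<^sub>1) = card (nbhd G x \<inter> C\<^sub>2) \<or>
        nbhd G x \<inter> (C\<^sub>1 \<union> C\<^sub>2) \<in> {C\<^sub>1, C\<^sub>2})"

definition switched_nbhd :: "'v graph \<Rightarrow> 'v set \<Rightarrow> 'v set \<Rightarrow> 'v \<Rightarrow> 'v set" where
  "switched_nbhd G C\<^sub>1 C\<^sub>2 x =
     (let N = nbhd G x \<inter> (C\<^sub>1 \<union> C\<^sub>2)
      in if N = C\<^sub>2 then C\<^sub>1 else if N = C\<^sub>1 then C\<^sub>2 else N)"

definition switch :: "'v graph \<Rightarrow> 'v set \<Rightarrow> 'v set \<Rightarrow> 'v graph" where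
  "switch G C\<^sub>1 C\<^sub>2 =
     \<lparr>verts = verts G,
      adj = (\<lambda>x y.
        let C = C\<^sub>1 \<union> C\<^sub>2; D = verts G - C in
        if x \<in> D \<and> y \<in> C then y \<in> switched_nbhd G C\<^sub>1 C\<^sub>2 x
        else if x \<in> C \<and> y \<in> D then x \<in> switched_nbhd G C\<^sub>1 C\<^sub>2 y
        else adj G x y)\<rparr>"

text \<open>There are no loops in odd characteristic, since a vertex is never contained in its own
  perpendicular space.\<close>

definition polar_graph :: "('a::field ^ 'n \<Rightarrow> 'a) \<Rightarrow> sign \<Rightarrow> ('a ^ 'n) set graph" where
  "polar_graph \<sigma> \<epsilon> = \<lparr>verts = points_of_sign \<sigma> \<epsilon>, adj = (\<lambda>x y. x \<subseteq> perp \<sigma> y)\<rparr>"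

end

theory Submission
  imports Defs "HOL-Computational_Algebra.Nth_Powers" "HOL-Library.Z2"
begin

text \<open>
  Write \<open>u \<cdot> v\<close> for half the polar form and \<open>L\<^sub>i = \<langle>v\<^sub>i\<rangle> + p\<close> with \<open>v\<^sub>1 \<cdot> v\<^sub>1 = v\<^sub>2 \<cdot> v\<^sub>2 = e\<close>; then
  \<open>C\<^sub>i\<close> consists of the points \<open>\<langle>v\<^sub>i + w\<rangle>\<close> with \<open>w \<in> p\<close>. A vector perpendicular to \<open>p\<close> sees all or
  nothing of \<open>C\<^sub>i\<close>; for any other vector \<open>u\<close> the solutions \<open>w\<close> of \<open>u \<cdot> (v\<^sub>i + w) = 0\<close> form a fibre
  of a nonzero functional on \<open>p\<close>. This gives the switching set.

  For the second part, products of reflections act transitively on the sets of \<open>k\<close> mutually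
  orthogonal points of \<open>\<Gamma>\<close>, so the number of common neighbours of a \<open>k\<close>-clique of \<open>\<Gamma>\<close> depends
  on \<open>k\<close> only. This fails for some cliques of size \<open>n - 3\<close> of the switched graph. Write
  \<open>p = \<langle>z + z'\<rangle>\<close> with \<open>z, z' \<bottom> v\<^sub>1, v\<^sub>2\<close> orthogonal of values \<open>e\<close> and \<open>- e\<close>. The type of \<open>P/p\<close> says
  that \<open>v\<^sub>1 = a v\<^sub>2 + r v'\<close> with \<open>v' \<bottom> v\<^sub>2\<close> of value \<open>e\<close>, \<open>a\<^sup>2 + r\<^sup>2 = 1\<close> and \<open>r \<noteq> 0\<close>. Take \<open>n - 5\<close>
  mutually orthogonal vectors \<open>Y\<close> of value \<open>e\<close> in \<open>{z, z', v\<^sub>2}\<^sup>\<bottom>\<close>, and let \<open>c e\<close> be the value of the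
  component of \<open>v'\<close> perpendicular to \<open>Y\<close>. Both \<open>{v\<^sub>2, z} \<union> Y\<close> in \<open>\<Gamma>\<close> and \<open>{v\<^sub>1, z} \<union> Y\<close> in the
  switched graph are cliques; they have the same common neighbours perpendicular to \<open>p\<close>, and the
  other ones are counted by \<open>\<alpha> i\<^sup>2 + \<beta> j\<^sup>2 - t\<^sup>2 = 1\<close>, \<open>t \<noteq> 0\<close>, for two pairs \<open>(\<alpha>, \<beta>)\<close> whose products
  \<open>\<alpha> \<beta>\<close> differ by the factor \<open>a\<^sup>2 + r\<^sup>2 c\<close>. The two counts differ if this factor is a non-square,
  and \<open>Y\<close> can be chosen with any prescribed \<open>c \<noteq> 0, 1\<close>, since \<open>n - 5 \<ge> 2\<close> and \<open>1 - c\<close> is a sum of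
  two squares.
\<close>

subsection \<open>Squares in a finite field of odd order\<close>

lemma even_card_involution:
  assumes "\<And>x. x \<in> A \<Longrightarrow> h x \<in> A" "\<And>x. x \<in> A \<Longrightarrow> h (h x) = x" "\<And>x. x \<in> A \<Longrightarrow> h x \<noteq> x"
  shows "even (card A)"
proof -
  have "(\<Sum>x\<in>A. 1) = (0::bit)"
    using assms by (intro sum_involution_eq_0[where h = h]) simp_all
  then have "even (of_nat (card A) :: bit)" by simp
  then show ?thesis by (simp only: even_of_nat)
qed

lemma two_neq_0_if_odd_card:
  assumes "odd CARD('a::{field,finite})"
  shows "(2::'a) \<noteq> 0"
proof
  assume "(2::'a) = 0"
  then have "x + 1 + 1 = x" for x :: 'a
    by (simp add: add.assoc)
  then have "even CARD('a)"
    by (intro even_card_involution[where h = "\<lambda>x. x + 1"]) simp_all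
  with assms show False by simp
qed

lemma card_eq_2_card_image:
  fixes f :: "'b::group_add \<Rightarrow> 'c"
  assumes "finite X"
    and minus_mem: "\<And>x. x \<in> X \<Longrightarrow> - x \<in> X \<and> - x \<noteq> x"
    and same_image: "\<And>x y. x \<in> X \<Longrightarrow> y \<in> X \<Longrightarrow> f y = f x \<longleftrightarrow> y = x \<or> y = - x"
  shows "card X = 2 * card (f ` X)"
proof -
  have "card {y \<in> X. f y = f x} = 2" if "x \<in> X" for x
  proof -
    have "{y \<in> X. f y = f x} = {x, - x}"
      using that minus_mem[OF that] same_image[OF that] by auto
    then show ?thesis using minus_mem[OF that] by auto
  qed
  then have "(\<Sum>z\<in>f ` X. card {y \<in> X. f y = z}) = (\<Sum>z\<in>f ` X. 2)"
    by (intro sum.cong) auto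
  moreover have "(\<Sum>z\<in>f ` X. card {y \<in> X. f y = z}) = card X"
    using sum.image_gen[OF \<open>finite X\<close>, of "\<lambda>_. 1::nat" f] by simp
  ultimately show ?thesis by simp
qed

lemma is_square_power2_mult_iff:
  fixes a :: "'a::field"
  assumes "a \<noteq> 0"
  shows "is_square (a\<^sup>2 * x) \<longleftrightarrow> is_square x"
proof
  assume "is_square (a\<^sup>2 * x)"
  then obtain y where "a\<^sup>2 * x = y\<^sup>2" by (rule is_nth_powerE)
  then have "x = (y / a)\<^sup>2" using assms by (simp add: field_simps)
  then show "is_square x" by (rule is_nth_powerI)
qed (simp add: is_nth_power_mult)

context
  assumes two_neq_0: "(2::'a::{field,finite}) \<noteq> 0"
begin

lemma minus_neq_self:
  fixes x :: 'a
  assumes "x \<noteq> 0"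
  shows "- x \<noteq> x"
proof
  assume "- x = x"
  then have "2 * x = 0" by (metis add.right_inverse mult_2)
  with assms two_neq_0 show False by simp
qed

lemma card_nonzero_squares: "2 * card {x::'a. x \<noteq> 0 \<and> is_square x} + 1 = CARD('a)"
proof -
  have "card (UNIV - {0::'a}) = 2 * card ((\<lambda>x. x\<^sup>2) ` (UNIV - {0::'a}))"
    by (rule card_eq_2_card_image) (auto simp: minus_neq_self power2_eq_iff)
  moreover have "(\<lambda>x. x\<^sup>2) ` (UNIV - {0::'a}) = {x. x \<noteq> 0 \<and> is_square x}"
    by (auto simp: is_nth_power_def)
  ultimately show ?thesis
    by (metis Suc_eq_plus1 UNIV_I card_Suc_Diff1 finite_class.finite_UNIV)
qed

lemma card_squares: "2 * card {x::'a. is_square x} = CARD('a) + 1"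
proof -
  have "{x::'a. is_square x} = insert 0 {x. x \<noteq> 0 \<and> is_square x}"
    by auto
  then have "card {x::'a. is_square x} = Suc (card {x::'a. x \<noteq> 0 \<and> is_square x})"
    by simp
  with card_nonzero_squares show ?thesis by simp
qed

lemma card_nonsquares: "2 * card {x::'a. \<not> is_square x} + 1 = CARD('a)"
proof -
  have "card {x::'a. is_square x} + card {x::'a. \<not> is_square x} = CARD('a)"
    by (subst card_Un_disjoint[symmetric]) (auto intro!: arg_cong[of _ _ card])
  with card_squares show ?thesis by simp
qed

lemma nonsquare_exists: "\<exists>x::'a. \<not> is_square x"
proof (rule ccontr)
  assume "\<nexists>x::'a. \<not> is_square x"
  then have "CARD('a) = 1" using card_nonsquares by simp
  moreover have "card {0, 1::'a} \<le> CARD('a)" by (rule card_mono) auto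
  ultimately show False by simp
qed

lemma is_square_mult_iff:
  fixes x y :: 'a
  assumes "x \<noteq> 0" "y \<noteq> 0"
  shows "is_square (x * y) \<longleftrightarrow> (is_square x \<longleftrightarrow> is_square y)"
proof -
  have square_factor: "is_square (u * v) \<longleftrightarrow> is_square v" if "is_square u" "u \<noteq> 0" for u v :: 'a
  proof -
    obtain a where "u = a\<^sup>2" using \<open>is_square u\<close> by (rule is_nth_powerE)
    with \<open>u \<noteq> 0\<close> show ?thesis by (simp add: is_square_power2_mult_iff)
  qed
  have "is_square (x * y)" if "\<not> is_square x" "\<not> is_square y"
  proof -
    let ?S = "{s::'a. s \<noteq> 0 \<and> is_square s}"
    have "(*) x ` ?S = {z. \<not> is_square z}"
    proof (rule card_subset_eq)
      show "(*) x ` ?S \<subseteq> {z. \<not> is_square z}"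
        using square_factor[of _ x] that(1) by (auto simp: mult.commute)
      have "card ((*) x ` ?S) = card ?S"
        using assms(1) by (intro card_image inj_onI) simp
      then show "card ((*) x ` ?S) = card {z::'a. \<not> is_square z}"
        using card_nonzero_squares card_nonsquares by simp
    qed simp
    then obtain s where "y = x * s" "is_square s" using \<open>\<not> is_square y\<close> by auto
    then have "x * y = x\<^sup>2 * s" by (simp add: power2_eq_square)
    then show ?thesis using \<open>is_square s\<close> by (simp add: is_nth_power_mult)
  qed
  then show ?thesis
    using square_factor[of x y] square_factor[of y x] assms by (auto simp: mult.commute)
qed

lemma is_square_minus_1_iff: "is_square (- 1 :: 'a) \<longleftrightarrow> CARD('a) mod 4 = 1"
proof -
  let ?S = "{x::'a. x \<noteq> 0 \<and> is_square x}"
  have "even (card ?S)" if "is_square (- 1 :: 'a)"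
  proof (rule even_card_involution[where h = uminus])
    show "- x \<in> ?S" if "x \<in> ?S" for x
      using that is_nth_power_mult[OF \<open>is_square (- 1)\<close>, of x] by simp
  qed (auto simp: minus_neq_self)
  moreover have "odd (card ?S)" if "\<not> is_square (- 1 :: 'a)"
  proof -
    have "even (card (?S - {1}))"
    proof (rule even_card_involution[where h = inverse])
      fix x assume x_mem: "x \<in> ?S - {1}"
      have "is_square (inverse x)"
        using x_mem by (auto elim!: is_nth_powerE simp flip: power_inverse)
      then show "inverse x \<in> ?S - {1}" using x_mem by simp
      show "inverse x \<noteq> x"
      proof
        assume "inverse x = x"
        then have "x\<^sup>2 = 1" using x_mem by (simp add: power2_eq_square) (metis right_inverse)
        with x_mem that show False by (auto simp: power2_eq_1_iff)
      qed
    qed simp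
    moreover have "card ?S = Suc (card (?S - {1}))"
      by (rule card.remove) simp_all
    ultimately show ?thesis by (metis even_Suc)
  qed
  moreover have "CARD('a) mod 4 = 1 \<longleftrightarrow> even (card ?S)"
    unfolding card_nonzero_squares[symmetric] by presburger
  ultimately show ?thesis by blast
qed

lemma nonsquare_combination:
  fixes a r :: 'a
  assumes "r \<noteq> 0" "a\<^sup>2 + r\<^sup>2 = 1"
  obtains c where "c \<noteq> 0" "c \<noteq> 1" "\<not> is_square (a\<^sup>2 + r\<^sup>2 * c)"
proof -
  obtain g :: 'a where nonsquare: "\<not> is_square g" using nonsquare_exists by blast
  show thesis
  proof (rule that[of "(g - a\<^sup>2) / r\<^sup>2"])
    show "\<not> is_square (a\<^sup>2 + r\<^sup>2 * ((g - a\<^sup>2) / r\<^sup>2))" using nonsquare assms(1) by simp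
    show "(g - a\<^sup>2) / r\<^sup>2 \<noteq> 0" using nonsquare assms(1) by auto
    show "(g - a\<^sup>2) / r\<^sup>2 \<noteq> 1"
    proof
      assume "(g - a\<^sup>2) / r\<^sup>2 = 1"
      then have "g = a\<^sup>2 + r\<^sup>2" using assms(1) by (simp add: field_simps)
      with nonsquare assms(2) show False by simp
    qed
  qed
qed

lemma binary_form_represents:
  fixes \<alpha> \<beta> c :: 'a
  assumes "\<alpha> \<noteq> 0" "\<beta> \<noteq> 0"
  obtains i j where "\<alpha> * i\<^sup>2 + \<beta> * j\<^sup>2 = c"
proof -
  let ?S = "{x::'a. is_square x}"
  let ?X = "(\<lambda>x. \<alpha> * x) ` ?S" and ?Y = "(\<lambda>x. c - \<beta> * x) ` ?S"
  have "card ?X = card ?S" "card ?Y = card ?S"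
    using assms by (auto intro!: card_image inj_onI)
  then have "CARD('a) < card ?X + card ?Y" using card_squares by simp
  moreover have "card (?X \<union> ?Y) \<le> CARD('a)" by (rule card_mono) auto
  ultimately have "?X \<inter> ?Y \<noteq> {}"
    using card_Un_disjoint[of ?X ?Y] by auto
  then obtain x y where "is_square x" "is_square y" "\<alpha> * x = c - \<beta> * y" by blast
  then obtain i j where "\<alpha> * i\<^sup>2 = c - \<beta> * j\<^sup>2" by (auto elim!: is_nth_powerE)
  then show thesis by (intro that[of i j]) simp
qed

end

subsection \<open>Counting points on a quadric\<close>

definition quadric_count :: "'a::field \<Rightarrow> 'a \<Rightarrow> nat" where
  "quadric_count \<alpha> \<beta> = card {(i, j, t). \<alpha> * i\<^sup>2 + \<beta> * j\<^sup>2 - t\<^sup>2 = 1 \<and> t \<noteq> 0}"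

context
  assumes two_neq_0: "(2::'a::{field,finite}) \<noteq> 0"
begin

lemma card_mult_eq:
  fixes c :: 'a
  shows "card {(r, s). r * s = c} + 1 = CARD('a) + (if c = 0 then CARD('a) else 0)"
proof -
  have card_nonzero: "card (UNIV - {0::'a}) + 1 = CARD('a)"
    by (simp add: card_Suc_Diff1)
  show ?thesis
  proof (cases "c = 0")
    case True
    then have "{(r, s). r * s = c} = {0} \<times> UNIV \<union> (UNIV - {0}) \<times> {0}" by auto
    moreover have "card ({0::'a} \<times> (UNIV::'a set) \<union> (UNIV - {0}) \<times> {0})
      = CARD('a) + card (UNIV - {0::'a})"
      by (subst card_Un_disjoint) (auto simp: card_cartesian_product)
    ultimately show ?thesis using True card_nonzero by simp
  next
    case False
    then have "{(r, s). r * s = c} = (\<lambda>r. (r, c / r)) ` (UNIV - {0})" by auto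
    moreover have "inj_on (\<lambda>r. (r, c / r)) (UNIV - {0})" by (rule inj_onI) simp
    ultimately have "card {(r, s). r * s = c} = card (UNIV - {0::'a})"
      by (simp only: card_image)
    then show ?thesis using False card_nonzero by simp
  qed
qed

lemma card_hyperbola:
  fixes c :: 'a
  shows "card {(x, t). x\<^sup>2 - t\<^sup>2 = c} + 1 = CARD('a) + (if c = 0 then CARD('a) else 0)"
proof -
  have half: "(y + y) / 2 = y" for y :: 'a
    using two_neq_0 by (metis mult_2 nonzero_mult_div_cancel_left)
  have half_sum: "(x + t + (x - t)) / 2 = x" "(x + t - (x - t)) / 2 = t" for x t :: 'a
    using half[of x] half[of t] by simp_all
  have sum_half: "(r + s) / 2 + (r - s) / 2 = r" "(r + s) / 2 - (r - s) / 2 = s" for r s :: 'a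
    using half[of r] half[of s] by (simp_all flip: add_divide_distrib diff_divide_distrib)
  have "bij_betw (\<lambda>(x, t). (x + t, x - t)) {(x, t). x\<^sup>2 - t\<^sup>2 = c} {(r, s). r * s = c}"
  proof (rule bij_betw_byWitness[where f' = "\<lambda>(r, s). ((r + s) / 2, (r - s) / 2)"])
    have "((r + s) / 2)\<^sup>2 - ((r - s) / 2)\<^sup>2 = r * s" for r s :: 'a
      by (simp only: sum_half square_diff_square_factored power2_eq_square)
    then show "(\<lambda>(r, s). ((r + s) / 2, (r - s) / 2)) ` {(r, s). r * s = c}
      \<subseteq> {(x, t). x\<^sup>2 - t\<^sup>2 = c}"
      by auto
    show "(\<lambda>(x, t). (x + t, x - t)) ` {(x, t). x\<^sup>2 - t\<^sup>2 = c} \<subseteq> {(r, s). r * s = c}"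
      by (auto simp: power2_eq_square algebra_simps)
  qed (auto simp: half_sum sum_half two_neq_0)
  then show ?thesis
    using card_mult_eq[of c] by (simp add: bij_betw_same_card)
qed

lemma quadric_count_eq_discriminant:
  fixes \<alpha> \<beta> :: 'a
  assumes "\<alpha> \<noteq> 0" "\<beta> \<noteq> 0"
  shows "quadric_count \<alpha> \<beta> = quadric_count (\<alpha> * \<beta>) 1"
proof -
  obtain k l where unit_value: "\<alpha> * k\<^sup>2 + \<beta> * l\<^sup>2 = 1"
    using binary_form_represents[OF two_neq_0 assms] .
  let ?f = "\<lambda>(w, x, t). (k * x - \<beta> * l * w, l * x + \<alpha> * k * w, t)"
  let ?g = "\<lambda>(i, j, t). (k * j - l * i, \<alpha> * k * i + \<beta> * l * j, t)"
  have form_f: "\<alpha> * (k * x - \<beta> * l * w)\<^sup>2 + \<beta> * (l * x + \<alpha> * k * w)\<^sup>2 = \<alpha> * \<beta> * w\<^sup>2 + x\<^sup>2" for x w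
  proof -
    have "\<alpha> * (k * x - \<beta> * l * w)\<^sup>2 + \<beta> * (l * x + \<alpha> * k * w)\<^sup>2
      = (\<alpha> * k\<^sup>2 + \<beta> * l\<^sup>2) * (\<alpha> * \<beta> * w\<^sup>2 + x\<^sup>2)" by algebra
    then show ?thesis using unit_value by simp
  qed
  have form_g: "\<alpha> * \<beta> * (k * j - l * i)\<^sup>2 + (\<alpha> * k * i + \<beta> * l * j)\<^sup>2 = \<alpha> * i\<^sup>2 + \<beta> * j\<^sup>2" for i j
  proof -
    have "\<alpha> * \<beta> * (k * j - l * i)\<^sup>2 + (\<alpha> * k * i + \<beta> * l * j)\<^sup>2
      = (\<alpha> * k\<^sup>2 + \<beta> * l\<^sup>2) * (\<alpha> * i\<^sup>2 + \<beta> * j\<^sup>2)" by algebra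
    then show ?thesis using unit_value by simp
  qed
  have inverse_left: "\<alpha> * k * (k * x - \<beta> * l * w) + \<beta> * l * (l * x + \<alpha> * k * w) = x"
    "k * (l * x + \<alpha> * k * w) - l * (k * x - \<beta> * l * w) = w" for x w
    using unit_value by algebra+
  have inverse_right: "k * (\<alpha> * k * i + \<beta> * l * j) - \<beta> * l * (k * j - l * i) = i"
    "l * (\<alpha> * k * i + \<beta> * l * j) + \<alpha> * k * (k * j - l * i) = j" for i j
    using unit_value by algebra+
  have "bij_betw ?f {(w, x, t). \<alpha> * \<beta> * w\<^sup>2 + 1 * x\<^sup>2 - t\<^sup>2 = 1 \<and> t \<noteq> 0}
     {(i, j, t). \<alpha> * i\<^sup>2 + \<beta> * j\<^sup>2 - t\<^sup>2 = 1 \<and> t \<noteq> 0}"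
    by (rule bij_betw_byWitness[where f' = ?g])
      (auto simp: inverse_left inverse_right form_f form_g)
  from bij_betw_same_card[OF this] show ?thesis
    unfolding quadric_count_def by (rule sym)
qed

lemma quadric_count_plus_conic:
  fixes \<Delta> :: 'a
  shows "quadric_count \<Delta> 1 + card {(i, j). \<Delta> * i\<^sup>2 + j\<^sup>2 = 1} + CARD('a)
    = CARD('a) * CARD('a) + CARD('a) * card {i. \<Delta> * i\<^sup>2 = 1}"
proof -
  let ?Q = "{(i, j, t). \<Delta> * i\<^sup>2 + j\<^sup>2 - t\<^sup>2 = 1}"
  have "card ?Q = card {(i, j, t). \<Delta> * i\<^sup>2 + j\<^sup>2 - t\<^sup>2 = 1 \<and> t \<noteq> 0}
    + card ((\<lambda>(i, j). (i, j, 0::'a)) ` {(i, j). \<Delta> * i\<^sup>2 + j\<^sup>2 = 1})"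
    by (subst card_Un_disjoint[symmetric]) (auto intro!: arg_cong[of _ _ card])
  then have card_Q: "card ?Q = quadric_count \<Delta> 1 + card {(i, j). \<Delta> * i\<^sup>2 + j\<^sup>2 = 1}"
    by (simp add: quadric_count_def card_image inj_on_def)
  have "?Q = (SIGMA i:UNIV. {(j, t). j\<^sup>2 - t\<^sup>2 = 1 - \<Delta> * i\<^sup>2})" by (auto simp: algebra_simps)
  then have "card ?Q + CARD('a) = (\<Sum>i\<in>UNIV. card {(j, t). j\<^sup>2 - t\<^sup>2 = 1 - \<Delta> * i\<^sup>2} + 1)"
    unfolding sum.distrib by simp
  also have "\<dots> = (\<Sum>i\<in>UNIV. CARD('a) + (if \<Delta> * i\<^sup>2 = 1 then CARD('a) else 0))"
    unfolding card_hyperbola by (auto intro!: sum.cong)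
  also have "\<dots> = CARD('a) * CARD('a) + CARD('a) * card {i. \<Delta> * i\<^sup>2 = 1}"
    by (simp add: sum.distrib flip: sum.inter_filter)
  finally show ?thesis unfolding card_Q by simp
qed

lemma card_conic_le:
  fixes \<Delta> :: 'a
  shows "card {(i, j). \<Delta> * i\<^sup>2 + j\<^sup>2 = 1} \<le> 2 * CARD('a)"
proof -
  have card_roots: "card {j::'a. j\<^sup>2 = c} \<le> 2" for c
  proof (cases "is_square c")
    case True
    then obtain r where "c = r\<^sup>2" by (rule is_nth_powerE)
    then have "{j. j\<^sup>2 = c} = {r, - r}" by (auto simp: power2_eq_iff)
    then show ?thesis by (simp add: card_insert_le_m1)
  next
    case False
    then have "{j. j\<^sup>2 = c} = {}" by (auto intro: is_nth_powerI)
    then show ?thesis by simp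
  qed
  have "{(i, j). \<Delta> * i\<^sup>2 + j\<^sup>2 = 1} = (SIGMA i:UNIV. {j. j\<^sup>2 = 1 - \<Delta> * i\<^sup>2})"
    by (auto simp: algebra_simps)
  then have "card {(i, j). \<Delta> * i\<^sup>2 + j\<^sup>2 = 1} = (\<Sum>i\<in>UNIV. card {j. j\<^sup>2 = 1 - \<Delta> * i\<^sup>2})"
    by simp
  also have "\<dots> \<le> (\<Sum>i\<in>(UNIV::'a set). 2)" by (intro sum_mono card_roots)
  finally show ?thesis by simp
qed

lemma quadric_count_nonsquare_less_square:
  fixes \<Delta> \<Delta>' :: 'a
  assumes "\<not> is_square \<Delta>" "is_square \<Delta>'" "\<Delta>' \<noteq> 0"
  shows "quadric_count \<Delta> 1 < quadric_count \<Delta>' 1"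
proof -
  have no_root: "{i. \<Delta> * i\<^sup>2 = 1} = {}"
  proof -
    have "\<Delta> = (1 / i)\<^sup>2" if "\<Delta> * i\<^sup>2 = 1" for i
      using that by (cases "i = 0") (auto simp: field_simps)
    with assms(1) show ?thesis by (auto intro: is_nth_powerI)
  qed
  have two_roots: "card {i. \<Delta>' * i\<^sup>2 = 1} = 2"
  proof -
    obtain r where \<Delta>'_eq: "\<Delta>' = r\<^sup>2" using assms(2) by (rule is_nth_powerE)
    with assms(3) have "r \<noteq> 0" by auto
    then have "\<Delta>' * i\<^sup>2 = 1 \<longleftrightarrow> i\<^sup>2 = (1 / r)\<^sup>2" for i by (auto simp: \<Delta>'_eq field_simps)
    then have "{i. \<Delta>' * i\<^sup>2 = 1} = {1 / r, - (1 / r)}" by (auto simp: power2_eq_iff)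
    then show ?thesis using minus_neq_self[OF two_neq_0, of "1 / r"] \<open>r \<noteq> 0\<close> by simp
  qed
  have "(0, 1) \<in> {(i, j). \<Delta> * i\<^sup>2 + j\<^sup>2 = 1}" by simp
  then have "card {(i, j). \<Delta> * i\<^sup>2 + j\<^sup>2 = 1} \<noteq> 0"
    unfolding card_0_eq[OF finite] by blast
  then show ?thesis
    using quadric_count_plus_conic[of \<Delta>] quadric_count_plus_conic[of \<Delta>'] card_conic_le[of \<Delta>']
    unfolding no_root two_roots card.empty by linarith
qed

lemma quadric_count_mult_nonsquare_neq:
  fixes \<alpha> \<beta> g :: 'a
  assumes "\<alpha> \<noteq> 0" "\<beta> \<noteq> 0" "\<not> is_square g"
  shows "quadric_count (\<alpha> * g) \<beta> \<noteq> quadric_count \<alpha> \<beta>"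
proof -
  have "g \<noteq> 0" using assms(3) by auto
  then have "is_square (\<alpha> * g * \<beta>) \<longleftrightarrow> \<not> is_square (\<alpha> * \<beta>)"
    using is_square_mult_iff[OF two_neq_0, of "\<alpha> * \<beta>" g] assms by (simp add: mult_ac)
  then have "quadric_count (\<alpha> * g * \<beta>) 1 \<noteq> quadric_count (\<alpha> * \<beta>) 1"
    using quadric_count_nonsquare_less_square[of "\<alpha> * \<beta>" "\<alpha> * g * \<beta>"]
      quadric_count_nonsquare_less_square[of "\<alpha> * g * \<beta>" "\<alpha> * \<beta>"] assms \<open>g \<noteq> 0\<close> by force
  then show ?thesis
    using quadric_count_eq_discriminant[of "\<alpha> * g" \<beta>] quadric_count_eq_discriminant[of \<alpha> \<beta>]
      assms \<open>g \<noteq> 0\<close> by simp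
qed

end

subsection \<open>Orthogonal systems in a quadratic space\<close>

locale quadratic_space =
  fixes \<sigma> :: "'a::{field,finite} ^ 'n \<Rightarrow> 'a"
  assumes quadratic_form: "quadratic_form \<sigma>"
    and nondegenerate: "nondegenerate \<sigma>"
    and two_neq_0: "(2::'a) \<noteq> 0"
begin

definition bilin :: "'a ^ 'n \<Rightarrow> 'a ^ 'n \<Rightarrow> 'a" (infixl "\<cdot>" 70) where
  "u \<cdot> v = polar \<sigma> u v / 2"

lemma bilin_add_left [simp]: "(u + v) \<cdot> w = u \<cdot> w + v \<cdot> w"
  and bilin_add_right [simp]: "w \<cdot> (u + v) = w \<cdot> u + w \<cdot> v"
  and bilin_scale_left [simp]: "(c *s u) \<cdot> w = c * (u \<cdot> w)"
  and bilin_scale_right [simp]: "w \<cdot> (c *s u) = c * (w \<cdot> u)"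
  using quadratic_form unfolding quadratic_form_def bilin_def
  by (auto simp: Vector_Spaces.linear_iff add_divide_distrib)

lemma bilin_commute: "u \<cdot> v = v \<cdot> u"
  by (simp add: bilin_def polar_def add.commute)

lemma bilin_zero_left [simp]: "0 \<cdot> w = 0"
  using bilin_scale_left[of 0 0 w] by simp

lemma bilin_minus_left [simp]: "(- u) \<cdot> w = - (u \<cdot> w)"
  using bilin_scale_left[of "-1" u w] by simp

lemma bilin_minus_right [simp]: "w \<cdot> (- u) = - (w \<cdot> u)"
  using bilin_scale_right[of w "-1" u] by simp

lemma bilin_diff_left [simp]: "(u - v) \<cdot> w = u \<cdot> w - v \<cdot> w"
  using bilin_add_left[of u "- v" w] by simp

lemma bilin_diff_right [simp]: "w \<cdot> (u - v) = w \<cdot> u - w \<cdot> v"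
  using bilin_add_right[of w u "- v"] by simp

lemma bilin_sum_left: "(\<Sum>x\<in>X. f x) \<cdot> w = (\<Sum>x\<in>X. f x \<cdot> w)"
  by (induction X rule: infinite_finite_induct) simp_all

lemma bilin_self: "v \<cdot> v = \<sigma> v"
proof -
  have "v + v = 2 *s v" by (simp add: vec_eq_iff)
  then have "\<sigma> (v + v) = 2\<^sup>2 * \<sigma> v"
    using quadratic_form unfolding quadratic_form_def by metis
  then show ?thesis
    using two_neq_0 by (simp add: bilin_def polar_def)
qed

lemma mem_perp_iff: "v \<in> perp \<sigma> S \<longleftrightarrow> (\<forall>s\<in>S. v \<cdot> s = 0)"
  using two_neq_0 by (simp add: perp_def bilin_def)

lemma perpD:
  assumes "v \<in> perp \<sigma> S" "s \<in> S"
  shows "v \<cdot> s = 0" and "s \<cdot> v = 0"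
  using assms bilin_commute[of s v] by (simp_all add: mem_perp_iff)

lemma subset_perp_commute: "X \<subseteq> perp \<sigma> Y \<longleftrightarrow> Y \<subseteq> perp \<sigma> X"
  unfolding subset_eq mem_perp_iff using bilin_commute by metis

lemma subspace_perp: "vec.subspace (perp \<sigma> S)"
  by (rule vec.subspaceI) (auto simp: mem_perp_iff)

lemma perp_span: "perp \<sigma> (vec.span S) = perp \<sigma> S"
proof
  show "perp \<sigma> S \<subseteq> perp \<sigma> (vec.span S)"
  proof
    fix v assume "v \<in> perp \<sigma> S"
    then have "S \<subseteq> perp \<sigma> {v}" using perpD(2) by (simp add: mem_perp_iff subset_eq)
    then have "vec.span S \<subseteq> perp \<sigma> {v}" by (rule vec.span_minimal[OF _ subspace_perp])
    then show "v \<in> perp \<sigma> (vec.span S)" using subset_perp_commute[of "{v}"] by simp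
  qed
qed (auto simp: mem_perp_iff vec.span_base)

lemma eq_0_if_bilin_eq_0: "(\<And>y. x \<cdot> y = 0) \<Longrightarrow> x = 0"
  using nondegenerate mem_perp_iff[of x UNIV] by (simp add: nondegenerate_def)

definition orthogonal_system :: "('a ^ 'n) set \<Rightarrow> bool" where
  "orthogonal_system X \<longleftrightarrow> pairwise (\<lambda>x y. x \<cdot> y = 0) X \<and> (\<forall>x\<in>X. x \<cdot> x \<noteq> 0)"

definition orthonormal :: "'a \<Rightarrow> ('a ^ 'n) set \<Rightarrow> bool" where
  "orthonormal e X \<longleftrightarrow> pairwise (\<lambda>x y. x \<cdot> y = 0) X \<and> (\<forall>x\<in>X. x \<cdot> x = e)"

lemma orthogonal_system_if_orthonormal: "orthonormal e X \<Longrightarrow> e \<noteq> 0 \<Longrightarrow> orthogonal_system X"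
  by (simp add: orthogonal_system_def orthonormal_def)

lemma orthogonal_system_subset: "orthogonal_system X \<Longrightarrow> Y \<subseteq> X \<Longrightarrow> orthogonal_system Y"
  unfolding orthogonal_system_def by (blast intro: pairwise_subset)

lemma orthogonal_system_insert:
  "orthogonal_system X \<Longrightarrow> x \<in> perp \<sigma> X \<Longrightarrow> x \<cdot> x \<noteq> 0 \<Longrightarrow> orthogonal_system (insert x X)"
  by (auto simp: orthogonal_system_def pairwise_insert dest: perpD)

lemma orthogonal_system_Un:
  "orthogonal_system X \<Longrightarrow> orthogonal_system Y \<Longrightarrow> Y \<subseteq> perp \<sigma> X \<Longrightarrow> orthogonal_system (X \<union> Y)"
  by (auto simp: orthogonal_system_def pairwise_def dest: perpD)

lemma orthonormal_insert:
  "orthonormal e X \<Longrightarrow> x \<in> perp \<sigma> X \<Longrightarrow> x \<cdot> x = e \<Longrightarrow> orthonormal e (insert x X)"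
  by (auto simp: orthonormal_def pairwise_insert dest: perpD)

lemma orthonormal_Un:
  "orthonormal e X \<Longrightarrow> orthonormal e Y \<Longrightarrow> Y \<subseteq> perp \<sigma> X \<Longrightarrow> orthonormal e (X \<union> Y)"
  by (auto simp: orthonormal_def pairwise_def dest: perpD)

lemma nonsingular_perp_notin: "x \<in> perp \<sigma> X \<Longrightarrow> x \<cdot> x \<noteq> 0 \<Longrightarrow> x \<notin> X"
  by (auto simp: mem_perp_iff)

lemma disjoint_if_subset_perp: "orthogonal_system Y \<Longrightarrow> Y \<subseteq> perp \<sigma> X \<Longrightarrow> X \<inter> Y = {}"
  using nonsingular_perp_notin unfolding orthogonal_system_def by blast

lemma subset_perp_if_orthogonal_system_Un:
  assumes "orthogonal_system (X \<union> Y)" "X \<inter> Y = {}"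
  shows "Y \<subseteq> perp \<sigma> X"
proof
  fix y assume "y \<in> Y"
  have "y \<cdot> x = 0" if "x \<in> X" for x
  proof -
    have "y \<noteq> x" using assms(2) \<open>y \<in> Y\<close> that by blast
    then show ?thesis
      using pairwiseD(1)[of "\<lambda>x y. x \<cdot> y = 0" "X \<union> Y" y x] assms(1) \<open>y \<in> Y\<close> that
      by (simp add: orthogonal_system_def)
  qed
  then show "y \<in> perp \<sigma> X" by (simp add: mem_perp_iff)
qed

lemma orthogonal_system_independent:
  assumes "orthogonal_system X"
  shows "vec.independent X"
proof
  assume "vec.dependent X"
  then obtain x where "x \<in> X" and dependent: "x \<in> vec.span (X - {x})"
    by (auto simp: vec.dependent_def)
  have "x \<in> perp \<sigma> (X - {x})"
    using assms \<open>x \<in> X\<close> by (auto simp: orthogonal_system_def mem_perp_iff pairwise_def)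
  then have "x \<cdot> x = 0"
    using dependent unfolding perp_span[symmetric, of "X - {x}"] mem_perp_iff by blast
  with assms \<open>x \<in> X\<close> show False by (simp add: orthogonal_system_def)
qed

lemma perp_projection:
  assumes "orthogonal_system X"
  shows "u - (\<Sum>x\<in>X. (u \<cdot> x / (x \<cdot> x)) *s x) \<in> perp \<sigma> X"
  unfolding mem_perp_iff
proof
  fix y assume "y \<in> X"
  have "(\<Sum>x\<in>X. (u \<cdot> x / (x \<cdot> x)) * (x \<cdot> y)) = (\<Sum>x\<in>X. if x = y then u \<cdot> y else 0)"
    using assms \<open>y \<in> X\<close> by (intro sum.cong) (auto simp: orthogonal_system_def pairwise_def)
  then show "(u - (\<Sum>x\<in>X. (u \<cdot> x / (x \<cdot> x)) *s x)) \<cdot> y = 0"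
    using \<open>y \<in> X\<close> by (simp add: bilin_sum_left)
qed

lemma perp_orthogonal_basis:
  assumes "orthogonal_system X" "card X = CARD('n)"
  shows "perp \<sigma> X = {0}"
proof -
  have "UNIV \<subseteq> vec.span X"
    using vec.card_ge_dim_independent[of X UNIV] orthogonal_system_independent[OF assms(1)] assms(2)
    by (simp add: vec_dim_card del: vec.dim_UNIV)
  then have "perp \<sigma> X = perp \<sigma> UNIV"
    using perp_span[of X] by (simp add: top.extremum_unique)
  then show ?thesis using nondegenerate by (simp add: nondegenerate_def)
qed

lemma perp_expansion:
  assumes basis: "orthogonal_system (X \<union> Y)" "card (X \<union> Y) = CARD('n)" and "X \<inter> Y = {}"
    and u_perp: "u \<in> perp \<sigma> X"
  shows "u = (\<Sum>y\<in>Y. (u \<cdot> y / (y \<cdot> y)) *s y)"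
proof -
  let ?w = "u - (\<Sum>y\<in>Y. (u \<cdot> y / (y \<cdot> y)) *s y)"
  have "Y \<subseteq> perp \<sigma> X"
    using basis(1) \<open>X \<inter> Y = {}\<close> by (rule subset_perp_if_orthogonal_system_Un)
  then have "?w \<in> perp \<sigma> X"
    using u_perp by (intro vec.subspace_diff vec.subspace_sum vec.subspace_scale subspace_perp) auto
  moreover have "?w \<in> perp \<sigma> Y"
    using basis(1) by (intro perp_projection) (auto intro: orthogonal_system_subset)
  ultimately have "?w \<in> perp \<sigma> (X \<union> Y)" by (auto simp: mem_perp_iff)
  then show ?thesis using perp_orthogonal_basis[OF basis] by simp
qed

lemma perp_nondegenerate:
  assumes "orthogonal_system X" and y_perp: "y \<in> perp \<sigma> X" and "y \<noteq> 0"
  obtains t where "t \<in> perp \<sigma> X" "y \<cdot> t \<noteq> 0"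
proof -
  obtain u where "y \<cdot> u \<noteq> 0" using eq_0_if_bilin_eq_0 \<open>y \<noteq> 0\<close> by blast
  let ?s = "\<Sum>x\<in>X. (u \<cdot> x / (x \<cdot> x)) *s x"
  have "?s \<cdot> y = 0"
    using y_perp by (auto simp: bilin_sum_left perpD(2) intro!: sum.neutral)
  then have "y \<cdot> (u - ?s) \<noteq> 0" using \<open>y \<cdot> u \<noteq> 0\<close> by (simp add: bilin_commute[of y ?s])
  with perp_projection[OF assms(1)] show thesis by (rule that)
qed

lemma perp_nonsingular:
  assumes "orthogonal_system X" "card X < CARD('n)"
  obtains v where "v \<in> perp \<sigma> X" "v \<cdot> v \<noteq> 0"
proof -
  have "vec.span X \<noteq> UNIV"
  proof
    assume "vec.span X = UNIV"
    then have "CARD('n) \<le> card X"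
      using vec.dim_le_card[of UNIV X] by (simp add: vec_dim_card del: vec.dim_UNIV)
    with assms(2) show False by simp
  qed
  then obtain u where u_notin: "u \<notin> vec.span X" by blast
  define y where "y = u - (\<Sum>x\<in>X. (u \<cdot> x / (x \<cdot> x)) *s x)"
  have y_perp: "y \<in> perp \<sigma> X" unfolding y_def by (rule perp_projection[OF assms(1)])
  have "(\<Sum>x\<in>X. (u \<cdot> x / (x \<cdot> x)) *s x) \<in> vec.span X"
    by (intro vec.span_sum vec.span_scale vec.span_base)
  then have "y \<noteq> 0" using u_notin by (auto simp: y_def)
  then obtain t where t_perp: "t \<in> perp \<sigma> X" and "y \<cdot> t \<noteq> 0"
    using perp_nondegenerate[OF assms(1) y_perp] by blast
  show thesis
  proof (cases "y \<cdot> y = 0 \<and> t \<cdot> t = 0")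
    case True
    then have "(y + t) \<cdot> (y + t) = 2 * (y \<cdot> t)" by (simp add: bilin_commute[of t y])
    also have "\<dots> \<noteq> 0" using \<open>y \<cdot> t \<noteq> 0\<close> two_neq_0 by simp
    finally show thesis by (rule that[OF vec.subspace_add[OF subspace_perp y_perp t_perp]])
  next
    case False
    then show thesis using that y_perp t_perp by blast
  qed
qed

lemma perp_represents:
  assumes orth: "orthogonal_system X" and card: "card X + 2 \<le> CARD('n)"
  obtains v where "v \<in> perp \<sigma> X" "v \<cdot> v = c"
proof -
  obtain x where x: "x \<in> perp \<sigma> X" "x \<cdot> x \<noteq> 0" using perp_nonsingular[OF orth] card by auto
  have "card (insert x X) < CARD('n)" using card by (simp add: card_insert_if)
  then obtain y where y: "y \<in> perp \<sigma> (insert x X)" "y \<cdot> y \<noteq> 0"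
    using perp_nonsingular[OF orthogonal_system_insert[OF orth x]] by blast
  obtain i j where ij: "(x \<cdot> x) * i\<^sup>2 + (y \<cdot> y) * j\<^sup>2 = c"
    using binary_form_represents[OF two_neq_0 x(2) y(2)] .
  have yx: "y \<cdot> x = 0" "x \<cdot> y = 0" using y(1) by (simp_all add: perpD)
  show thesis
  proof
    show "i *s x + j *s y \<in> perp \<sigma> X"
      using x(1) y(1) by (simp add: mem_perp_iff)
    show "(i *s x + j *s y) \<cdot> (i *s x + j *s y) = c"
      using ij yx by (simp add: power2_eq_square mult_ac)
  qed
qed

lemma orthonormal_in_perp:
  assumes orth: "orthogonal_system X" and "e \<noteq> 0" and "card X + k < CARD('n)"
  obtains Y where "Y \<subseteq> perp \<sigma> X" "orthonormal e Y" "card Y = k"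
  using assms(3)
proof (induction k arbitrary: thesis)
  case 0
  show ?case by (rule "0.prems"(1)[of "{}"]) (simp_all add: orthonormal_def)
next
  case (Suc k)
  obtain Y where Y: "Y \<subseteq> perp \<sigma> X" "orthonormal e Y" "card Y = k"
    using Suc.IH Suc.prems(2) by auto
  have "orthogonal_system (X \<union> Y)"
    using orth Y(1,2) \<open>e \<noteq> 0\<close> by (simp add: orthogonal_system_Un orthogonal_system_if_orthonormal)
  moreover have "card (X \<union> Y) + 2 \<le> CARD('n)"
    using card_Un_le[of X Y] Y(3) Suc.prems(2) by simp
  ultimately obtain v where v: "v \<in> perp \<sigma> (X \<union> Y)" "v \<cdot> v = e" by (rule perp_represents)
  then have "v \<in> perp \<sigma> X" "v \<in> perp \<sigma> Y" by (auto simp: mem_perp_iff)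
  moreover have "v \<notin> Y" using nonsingular_perp_notin \<open>v \<in> perp \<sigma> Y\<close> v(2) \<open>e \<noteq> 0\<close> by blast
  ultimately show ?case
    using Y v(2) by (intro Suc.prems(1)[of "insert v Y"]) (auto intro: orthonormal_insert)
qed

text \<open>A single vector need not suffice, since \<open>y \<cdot> y / e\<close> may be a non-square, but it is always
  a sum \<open>i\<^sup>2 + j\<^sup>2\<close>.\<close>

lemma orthonormal_pair_spanning_vector:
  assumes orth: "orthogonal_system X" and card: "card X + 2 < CARD('n)"
    and y: "y \<in> perp \<sigma> X" "y \<cdot> y \<noteq> 0" and "e \<noteq> 0"
  obtains Y where "Y \<subseteq> perp \<sigma> X" "orthonormal e Y" "card Y = 2" "y \<in> vec.span Y"
proof -
  define \<nu> where "\<nu> = y \<cdot> y / e"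
  have \<nu>: "y \<cdot> y = e * \<nu>" "\<nu> \<noteq> 0" using y(2) \<open>e \<noteq> 0\<close> by (simp_all add: \<nu>_def)
  obtain i j where sum_squares: "i\<^sup>2 + j\<^sup>2 = \<nu>"
    using binary_form_represents[OF two_neq_0, of 1 1 \<nu>] by auto
  have "card (insert y X) + 2 \<le> CARD('n)" using card by (simp add: card_insert_if)
  then obtain y' where y': "y' \<in> perp \<sigma> (insert y X)" "y' \<cdot> y' = e * \<nu>"
    using perp_represents[OF orthogonal_system_insert[OF orth y]] by blast
  have y'y: "y' \<cdot> y = 0" "y \<cdot> y' = 0" using y'(1) by (simp_all add: perpD)
  define y\<^sub>1 where "y\<^sub>1 = (i / \<nu>) *s y + (j / \<nu>) *s y'"
  define y\<^sub>2 where "y\<^sub>2 = (j / \<nu>) *s y - (i / \<nu>) *s y'"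
  have "i / \<nu> * (i / \<nu> * (e * \<nu>)) + j / \<nu> * (j / \<nu> * (e * \<nu>)) = e * (i\<^sup>2 + j\<^sup>2) / \<nu>"
    using \<nu>(2) by (simp add: field_simps power2_eq_square)
  also have "\<dots> = e" using sum_squares \<nu>(2) by simp
  finally have products: "y\<^sub>1 \<cdot> y\<^sub>1 = e" "y\<^sub>2 \<cdot> y\<^sub>2 = e" "y\<^sub>1 \<cdot> y\<^sub>2 = 0" "y\<^sub>2 \<cdot> y\<^sub>1 = 0"
    by (simp_all add: y\<^sub>1_def y\<^sub>2_def y'y y'(2) \<nu>(1) algebra_simps)
  show thesis
  proof
    show "{y\<^sub>1, y\<^sub>2} \<subseteq> perp \<sigma> X"
      using y(1) y'(1) by (auto simp: y\<^sub>1_def y\<^sub>2_def mem_perp_iff)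
    show "orthonormal e {y\<^sub>1, y\<^sub>2}"
      using products by (simp add: orthonormal_def pairwise_insert)
    have "y\<^sub>1 \<noteq> y\<^sub>2" using products \<open>e \<noteq> 0\<close> by auto
    then show "card {y\<^sub>1, y\<^sub>2} = 2" by simp
    have "i *s y\<^sub>1 + j *s y\<^sub>2 = ((i\<^sup>2 + j\<^sup>2) / \<nu>) *s y"
      by (simp add: y\<^sub>1_def y\<^sub>2_def vec_eq_iff algebra_simps power2_eq_square add_divide_distrib)
    then have "y = i *s y\<^sub>1 + j *s y\<^sub>2" using sum_squares \<nu>(2) by simp
    then show "y \<in> vec.span {y\<^sub>1, y\<^sub>2}" by (simp add: vec.span_add vec.span_scale vec.span_base)
  qed
qed

lemma orthonormal_spanning_vector:
  assumes orth: "orthogonal_system X" and y: "y \<in> perp \<sigma> X" "y \<cdot> y \<noteq> 0" and "e \<noteq> 0"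
    and card: "2 \<le> k" "card X + k < CARD('n)"
  obtains Y where "Y \<subseteq> perp \<sigma> X" "orthonormal e Y" "card Y = k" "y \<in> vec.span Y"
proof -
  obtain Y where Y: "Y \<subseteq> perp \<sigma> X" "orthonormal e Y" "card Y = 2" "y \<in> vec.span Y"
    using orthonormal_pair_spanning_vector[OF orth _ y \<open>e \<noteq> 0\<close>] card by auto
  have "orthogonal_system (X \<union> Y)"
    using orth Y(1,2) \<open>e \<noteq> 0\<close> by (simp add: orthogonal_system_Un orthogonal_system_if_orthonormal)
  moreover have "card (X \<union> Y) + (k - 2) < CARD('n)" using card_Un_le[of X Y] Y(3) card by simp
  ultimately obtain Z where Z: "Z \<subseteq> perp \<sigma> (X \<union> Y)" "orthonormal e Z" "card Z = k - 2"
    using orthonormal_in_perp \<open>e \<noteq> 0\<close> by metis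
  have Z_perp: "Z \<subseteq> perp \<sigma> X" "Z \<subseteq> perp \<sigma> Y" using Z(1) by (auto simp: mem_perp_iff)
  show thesis
  proof
    show "Y \<union> Z \<subseteq> perp \<sigma> X" using Y(1) Z_perp(1) by blast
    show "orthonormal e (Y \<union> Z)" using Y(2) Z(2) Z_perp(2) by (rule orthonormal_Un)
    have "Y \<inter> Z = {}"
      using orthogonal_system_if_orthonormal[OF Z(2) \<open>e \<noteq> 0\<close>] Z_perp(2)
      by (rule disjoint_if_subset_perp)
    then show "card (Y \<union> Z) = k" using Y(3) Z(3) card(1) by (simp add: card_Un_disjoint)
    show "y \<in> vec.span (Y \<union> Z)" using Y(4) vec.span_mono[of Y "Y \<union> Z"] by blast
  qed
qed

lemma perp_component:
  assumes orth: "orthogonal_system X" and card: "card X + 3 \<le> CARD('n)"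
    and v: "v \<in> perp \<sigma> X" "v \<cdot> v \<noteq> 0"
  obtains w where "w \<in> perp \<sigma> X" "w \<cdot> w = c * (v \<cdot> v)" "w \<cdot> v = c * (v \<cdot> v)"
proof -
  have "card (insert v X) + 2 \<le> CARD('n)" using card by (simp add: card_insert_if)
  then obtain u where u: "u \<in> perp \<sigma> (insert v X)" "u \<cdot> u = c * (1 - c) * (v \<cdot> v)"
    using perp_represents[OF orthogonal_system_insert[OF orth v]] by blast
  have uv: "u \<cdot> v = 0" "v \<cdot> u = 0" using u(1) by (simp_all add: perpD)
  show thesis
  proof
    show "c *s v + u \<in> perp \<sigma> X" using v(1) u(1) by (simp add: mem_perp_iff)
    show "(c *s v + u) \<cdot> (c *s v + u) = c * (v \<cdot> v)" "(c *s v + u) \<cdot> v = c * (v \<cdot> v)"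
      using uv u(2) by (simp_all add: algebra_simps)
  qed
qed

lemma hyperbolic_pair:
  assumes orth: "orthogonal_system X" and p: "p \<in> perp \<sigma> X" "p \<noteq> 0" "p \<cdot> p = 0" and "e \<noteq> 0"
  obtains z z' where "z + z' = p" "z \<in> perp \<sigma> X" "z \<cdot> z = e" "z' \<cdot> z' = - e"
    "orthogonal_system ({z, z'} \<union> X)" "card ({z, z'} \<union> X) = card X + 2"
proof -
  obtain t where t: "t \<in> perp \<sigma> X" "p \<cdot> t \<noteq> 0" using perp_nondegenerate[OF orth p(1,2)] .
  define t' where "t' = (e / (p \<cdot> t)) *s t"
  have t': "t' \<in> perp \<sigma> X" "t' \<cdot> p = e" "p \<cdot> t' = e"
    using t by (simp_all add: t'_def mem_perp_iff bilin_commute[of t p])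
  define k where "k = (e - t' \<cdot> t') / (2 * e)"
  have k: "2 * e * k = e - t' \<cdot> t'" using \<open>e \<noteq> 0\<close> two_neq_0 by (simp add: k_def)
  define z where "z = t' + k *s p"
  have z_perp: "z \<in> perp \<sigma> X" using t'(1) p(1) by (simp add: z_def mem_perp_iff)
  have z: "z \<cdot> z = e" "z \<cdot> p = e" "p \<cdot> z = e"
    using k p(3) t'(2,3) by (simp_all add: z_def algebra_simps)
  define z' where "z' = p - z"
  have z': "z' \<in> perp \<sigma> (insert z X)" "z' \<cdot> z' = - e"
    using z_perp p(1,3) z by (simp_all add: z'_def mem_perp_iff)
  have orth_z: "orthogonal_system (insert z X)"
    using orth z_perp z(1) \<open>e \<noteq> 0\<close> by (intro orthogonal_system_insert) simp_all
  show thesis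
  proof
    show "z + z' = p" by (simp add: z'_def)
    show "orthogonal_system ({z, z'} \<union> X)"
      using orthogonal_system_insert[OF orth_z z'(1)] z'(2) \<open>e \<noteq> 0\<close> by (simp add: insert_commute)
    have "z \<notin> X" "z' \<notin> insert z X"
      using nonsingular_perp_notin[OF z_perp] nonsingular_perp_notin[OF z'(1)] z(1) z'(2) \<open>e \<noteq> 0\<close>
      by simp_all
    then show "card ({z, z'} \<union> X) = card X + 2" by (auto simp: card_insert_if)
  qed fact+
qed

subsection \<open>Isometries\<close>

definition isometry :: "('a ^ 'n \<Rightarrow> 'a ^ 'n) \<Rightarrow> bool" where
  "isometry g \<longleftrightarrow> (\<forall>u v. g u \<cdot> g v = u \<cdot> v)"

lemma isometry_imp_inj:
  assumes "isometry g"
  shows "inj g"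
proof (rule injI)
  fix x y assume "g x = g y"
  then have "(x - y) \<cdot> w = 0" for w
    using assms unfolding isometry_def by (metis bilin_diff_left right_minus_eq)
  then show "x = y" using eq_0_if_bilin_eq_0[of "x - y"] by simp
qed

definition reflection :: "'a ^ 'n \<Rightarrow> 'a ^ 'n \<Rightarrow> 'a ^ 'n" where
  "reflection r u = u - (2 * (u \<cdot> r) / (r \<cdot> r)) *s r"

lemma isometry_reflection:
  assumes "r \<cdot> r \<noteq> 0"
  shows "isometry (reflection r)"
  unfolding isometry_def
proof (intro allI)
  fix u v
  show "reflection r u \<cdot> reflection r v = u \<cdot> v"
    using assms by (simp add: reflection_def bilin_commute[of r v] field_simps)
qed

lemma reflection_fixes_perp: "u \<cdot> r = 0 \<Longrightarrow> reflection r u = u"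
  by (simp add: reflection_def)

lemma reflection_diff:
  assumes "x \<cdot> x = y \<cdot> y" "(x - y) \<cdot> (x - y) \<noteq> 0"
  shows "reflection (x - y) x = y"
proof -
  have "(x - y) \<cdot> (x - y) = 2 * (x \<cdot> (x - y))"
    using assms(1) by (simp add: bilin_commute[of y x])
  then show ?thesis
    using assms(2) by (simp add: reflection_def del: bilin_diff_left bilin_diff_right)
qed

lemma isometry_swap_up_to_sign:
  assumes xy: "x \<cdot> x = e" "y \<cdot> y = e" and e: "e \<noteq> 0"
  obtains g where "isometry g" "g x = y \<or> g x = - y" "\<And>t. t \<cdot> x = 0 \<Longrightarrow> t \<cdot> y = 0 \<Longrightarrow> g t = t"
proof -
  have "(x - y) \<cdot> (x - y) + (x + y) \<cdot> (x + y) = 2 * 2 * e" using xy by simp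
  then consider "(x - y) \<cdot> (x - y) \<noteq> 0" | "(x - - y) \<cdot> (x - - y) \<noteq> 0"
    using e two_neq_0 by (metis add.right_neutral diff_minus_eq_add mult_eq_0_iff)
  then show thesis
  proof cases
    case 1
    then show thesis
      using xy by (intro that[of "reflection (x - y)"])
        (simp_all add: isometry_reflection reflection_diff reflection_fixes_perp)
  next
    case 2
    then show thesis
      using xy reflection_diff[of x "- y"] by (intro that[of "reflection (x - - y)"])
        (simp_all add: isometry_reflection reflection_fixes_perp)
  qed
qed

lemma isometry_orthonormal:
  assumes "e \<noteq> 0" "orthonormal e X" "orthonormal e Y" "card X = card Y"
  obtains g where "isometry g" "\<And>y. y \<in> Y \<Longrightarrow> \<exists>x\<in>X. y = g x \<or> y = - g x"
proof -
  have "finite X" by simp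
  then have "\<exists>g. isometry g \<and> (\<forall>y\<in>Y. \<exists>x\<in>X. y = g x \<or> y = - g x)"
    using assms(2-4)
  proof (induction X arbitrary: Y rule: finite_induct)
    case empty
    then have "Y = {}" by simp
    then show ?case by (auto simp: isometry_def intro!: exI[of _ id])
  next
    case (insert x X)
    then obtain y Y' where Y: "Y = insert y Y'" "y \<notin> Y'" "card X = card Y'"
      by (metis card_Suc_eq card_insert_disjoint)
    have orth: "orthonormal e X" "x \<in> perp \<sigma> X" "x \<cdot> x = e"
      "orthonormal e Y'" "y \<in> perp \<sigma> Y'" "y \<cdot> y = e"
      using insert.prems(1,2) insert.hyps(2) Y(2)
      by (auto simp: Y(1) orthonormal_def pairwise_insert mem_perp_iff)
    obtain g where g: "isometry g" "\<forall>y\<in>Y'. \<exists>x\<in>X. y = g x \<or> y = - g x"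
      using insert.IH orth(1,4) Y(3) by blast
    have "g x \<cdot> g x = e" using g(1) orth(3) by (simp add: isometry_def)
    then obtain h where h: "isometry h" "h (g x) = y \<or> h (g x) = - y"
      "\<And>t. t \<cdot> g x = 0 \<Longrightarrow> t \<cdot> y = 0 \<Longrightarrow> h t = t"
      using isometry_swap_up_to_sign orth(6) \<open>e \<noteq> 0\<close> by metis
    have "\<exists>x'\<in>X. y' = h (g x') \<or> y' = - h (g x')" if "y' \<in> Y'" for y'
    proof -
      obtain x' where x': "x' \<in> X" "y' = g x' \<or> y' = - g x'" using g(2) \<open>y' \<in> Y'\<close> by blast
      have "g x' \<cdot> g x = 0"
        using g(1) orth(2) x'(1) by (simp add: isometry_def perpD)
      moreover have "g x' \<cdot> y = 0"
        using orth(5) \<open>y' \<in> Y'\<close> x'(2) by (auto dest: perpD)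
      ultimately have "h (g x') = g x'" by (rule h(3))
      with x' show ?thesis by (intro bexI[of _ x']) simp_all
    qed
    then show ?case
      using g(1) h(1,2) by (auto simp: Y(1) isometry_def intro!: exI[of _ "h \<circ> g"])
  qed
  with that show thesis by blast
qed

definition perp_level :: "'a \<Rightarrow> ('a ^ 'n) set \<Rightarrow> ('a ^ 'n) set" where
  "perp_level c X = {u \<in> perp \<sigma> X. u \<cdot> u = c}"

lemma card_perp_level_le:
  assumes "e \<noteq> 0" "orthonormal e X" "orthonormal e Y" "card X = card Y"
  shows "card (perp_level c X) \<le> card (perp_level c Y)"
proof -
  obtain g where g: "isometry g" "\<And>y. y \<in> Y \<Longrightarrow> \<exists>x\<in>X. y = g x \<or> y = - g x"
    using isometry_orthonormal[OF assms] by blast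
  have "g u \<in> perp_level c Y" if "u \<in> perp_level c X" for u
  proof -
    have "g u \<cdot> g x = 0" if "x \<in> X" for x
      using \<open>u \<in> perp_level c X\<close> that g(1) by (simp add: perp_level_def mem_perp_iff isometry_def)
    then have "g u \<cdot> y = 0" if "y \<in> Y" for y using g(2)[OF that] by auto
    then show ?thesis using that g(1) by (simp add: perp_level_def mem_perp_iff isometry_def)
  qed
  then show ?thesis
    using isometry_imp_inj[OF g(1)] by (intro card_inj_on_le[of g]) (auto intro: inj_on_subset)
qed

lemma card_perp_level_eq:
  assumes "e \<noteq> 0" "orthonormal e X" "orthonormal e Y" "card X = card Y"
  shows "card (perp_level c X) = card (perp_level c Y)"
  using assms by (intro antisym card_perp_level_le[of e]) simp_all

lemma card_perp_level_off_hyperplane: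
  assumes basis: "orthogonal_system (X \<union> {f, g, h})" "card (X \<union> {f, g, h}) = CARD('n)"
    and card: "card X + 3 = CARD('n)"
    and norms: "f \<cdot> f = - e" "g \<cdot> g = e * \<alpha>" "h \<cdot> h = e * \<beta>"
  shows "card {u \<in> perp_level e X. u \<cdot> f \<noteq> 0} = quadric_count \<alpha> \<beta>"
proof -
  let ?Q = "{(i, j, t). \<alpha> * i\<^sup>2 + \<beta> * j\<^sup>2 - t\<^sup>2 = 1 \<and> t \<noteq> 0}"
  define lin where "lin = (\<lambda>(i, j, t). t *s f + i *s g + j *s h)"
  have distinct: "f \<noteq> g" "f \<noteq> h" "g \<noteq> h" "X \<inter> {f, g, h} = {}"
    using basis(2) card by (auto simp: card_insert_if split: if_splits)
  have nonzero: "e \<noteq> 0" "\<alpha> \<noteq> 0" "\<beta> \<noteq> 0"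
    using basis(1) norms by (auto simp: orthogonal_system_def)
  have perp: "f \<cdot> g = 0" "f \<cdot> h = 0" "g \<cdot> f = 0" "g \<cdot> h = 0" "h \<cdot> f = 0" "h \<cdot> g = 0"
    "f \<in> perp \<sigma> X" "g \<in> perp \<sigma> X" "h \<in> perp \<sigma> X"
    using basis(1) distinct by (auto simp: orthogonal_system_def pairwise_insert mem_perp_iff)
  have products: "lin (i, j, t) \<cdot> f = - e * t" "lin (i, j, t) \<cdot> g = e * \<alpha> * i"
    "lin (i, j, t) \<cdot> h = e * \<beta> * j"
    "lin (i, j, t) \<cdot> lin (i, j, t) = e * (\<alpha> * i\<^sup>2 + \<beta> * j\<^sup>2 - t\<^sup>2)" for i j t
    by (simp_all add: lin_def perp norms power2_eq_square algebra_simps)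
  have lin_perp: "lin (i, j, t) \<in> perp \<sigma> X" for i j t
    using perp by (simp add: lin_def mem_perp_iff)
  have lin_mem: "lin (i, j, t) \<in> {u \<in> perp_level e X. u \<cdot> f \<noteq> 0} \<longleftrightarrow> (i, j, t) \<in> ?Q" for i j t
    using lin_perp nonzero by (simp add: perp_level_def products)
  have "inj lin"
  proof (rule injI)
    fix a b assume "lin a = lin b"
    moreover obtain i j t i' j' t' where ab: "a = (i, j, t)" "b = (i', j', t')"
      by (metis prod.exhaust)
    ultimately have "lin (i, j, t) \<cdot> x = lin (i', j', t') \<cdot> x" for x by simp
    from this[of f] this[of g] this[of h] show "a = b"
      unfolding products ab using nonzero by simp
  qed
  moreover have "{u \<in> perp_level e X. u \<cdot> f \<noteq> 0} = lin ` ?Q"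
  proof (intro equalityI subsetI)
    fix u assume u: "u \<in> {u \<in> perp_level e X. u \<cdot> f \<noteq> 0}"
    have "u = (\<Sum>y\<in>{f, g, h}. (u \<cdot> y / (y \<cdot> y)) *s y)"
      using u by (intro perp_expansion[OF basis distinct(4)]) (simp add: perp_level_def)
    then have "u = lin (u \<cdot> g / (g \<cdot> g), u \<cdot> h / (h \<cdot> h), u \<cdot> f / (f \<cdot> f))"
      using distinct by (simp add: lin_def add.assoc)
    with u show "u \<in> lin ` ?Q" using lin_mem by (metis (no_types, lifting) image_eqI)
  qed (use lin_mem in blast)
  ultimately show ?thesis
    unfolding quadric_count_def by (simp add: card_image inj_on_subset)
qed

end

subsection \<open>Cliques and switching\<close>

definition clique :: "'v graph \<Rightarrow> 'v set \<Rightarrow> bool" where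
  "clique G K \<longleftrightarrow> K \<subseteq> verts G \<and> pairwise (adj G) K"

definition common_nbhd :: "'v graph \<Rightarrow> 'v set \<Rightarrow> 'v set" where
  "common_nbhd G K = {x \<in> verts G. \<forall>k\<in>K. adj G x k}"

lemma graph_iso_clique:
  assumes "graph_iso G H" "clique G K"
  obtains K' where "clique H K'" "card K' = card K"
    "card (common_nbhd H K') = card (common_nbhd G K)"
proof -
  obtain f where bij: "bij_betw f (verts G) (verts H)"
    and adj: "\<And>x y. x \<in> verts G \<Longrightarrow> y \<in> verts G \<Longrightarrow> adj H (f x) (f y) \<longleftrightarrow> adj G x y"
    using assms(1) unfolding graph_iso_def by blast
  have K_subset: "K \<subseteq> verts G" using assms(2) by (simp add: clique_def)
  have inj: "inj_on f A" if "A \<subseteq> verts G" for A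
    using bij that by (auto simp: bij_betw_def intro: inj_on_subset)
  have surj: "f ` verts G = verts H" using bij by (simp add: bij_betw_def)
  show thesis
  proof
    show "clique H (f ` K)"
      unfolding clique_def
    proof
      show "f ` K \<subseteq> verts H" using K_subset surj by blast
      show "pairwise (adj H) (f ` K)"
        using assms(2) adj by (intro pairwise_imageI) (simp add: clique_def pairwise_def subset_eq)
    qed
    show "card (f ` K) = card K" by (rule card_image[OF inj[OF K_subset]])
    have "common_nbhd H (f ` K) = f ` common_nbhd G K"
      using K_subset adj by (fastforce simp: common_nbhd_def simp flip: surj)
    moreover have "inj_on f (common_nbhd G K)" by (rule inj) (simp add: common_nbhd_def)
    ultimately show "card (common_nbhd H (f ` K)) = card (common_nbhd G K)"
      by (simp add: card_image)
  qed
qed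

lemma verts_switch [simp]: "verts (switch G C\<^sub>1 C\<^sub>2) = verts G"
  by (simp add: switch_def)

lemma adj_switch_same_side:
  "(x \<in> C\<^sub>1 \<union> C\<^sub>2 \<longleftrightarrow> y \<in> C\<^sub>1 \<union> C\<^sub>2) \<Longrightarrow> adj (switch G C\<^sub>1 C\<^sub>2) x y \<longleftrightarrow> adj G x y"
  by (auto simp: switch_def Let_def)

lemma adj_switch_across:
  assumes "x \<in> verts G - (C\<^sub>1 \<union> C\<^sub>2)" "y \<in> C\<^sub>1 \<union> C\<^sub>2"
  shows "adj (switch G C\<^sub>1 C\<^sub>2) x y \<longleftrightarrow> y \<in> switched_nbhd G C\<^sub>1 C\<^sub>2 x"
    and "adj (switch G C\<^sub>1 C\<^sub>2) y x \<longleftrightarrow> y \<in> switched_nbhd G C\<^sub>1 C\<^sub>2 x"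
  using assms by (auto simp: switch_def Let_def)

lemma switched_nbhd_swap:
  assumes nbhd: "nbhd G x \<inter> (C\<^sub>1 \<union> C\<^sub>2) = (if P then C\<^sub>1 else {}) \<union> (if Q then C\<^sub>2 else {})"
    and "C\<^sub>1 \<noteq> {}" "C\<^sub>2 \<noteq> {}" "C\<^sub>1 \<inter> C\<^sub>2 = {}"
  shows "switched_nbhd G C\<^sub>1 C\<^sub>2 x = (if Q then C\<^sub>1 else {}) \<union> (if P then C\<^sub>2 else {})"
proof -
  have "C\<^sub>1 \<noteq> C\<^sub>2" "C\<^sub>1 \<union> C\<^sub>2 \<noteq> C\<^sub>1" "C\<^sub>1 \<union> C\<^sub>2 \<noteq> C\<^sub>2" "{} \<noteq> C\<^sub>1" "{} \<noteq> C\<^sub>2"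
    using assms(2-4) by blast+
  then show ?thesis
    unfolding switched_nbhd_def nbhd by (cases P; cases Q) simp_all
qed

lemma switched_nbhd_unchanged:
  "nbhd G x \<inter> (C\<^sub>1 \<union> C\<^sub>2) \<notin> {C\<^sub>1, C\<^sub>2} \<Longrightarrow>
    switched_nbhd G C\<^sub>1 C\<^sub>2 x = nbhd G x \<inter> (C\<^sub>1 \<union> C\<^sub>2)"
  by (simp add: switched_nbhd_def)

subsection \<open>Subspaces and points\<close>

lemma subspace_scale_mem_iff:
  fixes S :: "('a::field ^ 'n) set"
  assumes "vec.subspace S" "c \<noteq> 0"
  shows "c *s v \<in> S \<longleftrightarrow> v \<in> S"
proof
  assume "c *s v \<in> S"
  then have "(1 / c) *s (c *s v) \<in> S" by (rule vec.subspace_scale[OF assms(1)])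
  then show "v \<in> S" using assms(2) by simp
qed (rule vec.subspace_scale[OF assms(1)])

lemma span_set_plus: "vec.span A + vec.span B = vec.span (A \<union> B)"
  for A B :: "('a::field ^ 'n) set"
  by (auto simp: vec.span_Un set_plus_def)

lemma mem_span_insert_iff:
  fixes p :: "('a::field ^ 'n) set"
  assumes "vec.subspace p"
  shows "x \<in> vec.span (insert v p) \<longleftrightarrow> (\<exists>c. x - c *s v \<in> p)"
  using assms by (simp add: vec.span_insert vec.span_eq_iff[THEN iffD2])

lemma span_insert_eq_if_dim_eq_Suc:
  fixes p L :: "('a::field ^ 'n) set"
  assumes "vec.subspace p" "vec.subspace L" "p \<subseteq> L" "vec.dim L = Suc (vec.dim p)"
    and "v \<in> L" "v \<notin> p"
  shows "vec.span (insert v p) = L"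
proof (rule vec.subspace_dim_equal)
  show "vec.span (insert v p) \<subseteq> L" using assms by (intro vec.span_minimal) auto
  have "v \<notin> vec.span p" using assms(1,6) by (simp add: vec.span_eq_iff[THEN iffD2])
  then show "vec.dim L \<le> vec.dim (vec.span (insert v p))"
    using assms(4) by (simp add: vec.dim_insert)
qed (use assms in auto)

lemma independent_modulo_intersection:
  fixes L L' :: "('a::field ^ 'n) set"
  assumes L: "vec.subspace L" "v \<in> L" "v \<notin> L'" and L': "vec.subspace L'" "v' \<in> L'" "v' \<notin> L"
    and combination: "c *s v + d *s v' \<in> L \<inter> L'"
  shows "c = 0 \<and> d = 0"
proof -
  have "c *s v + d *s v' - d *s v' \<in> L'" "c *s v + d *s v' - c *s v \<in> L"
    using combination L(1,2) L'(1,2) by (blast intro: vec.subspace_diff vec.subspace_scale)+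
  then have "c *s v \<in> L'" "d *s v' \<in> L" by simp_all
  then show ?thesis
    using subspace_scale_mem_iff[OF L'(1)] subspace_scale_mem_iff[OF L(1)] L(3) L'(3) by blast
qed

definition point :: "'a::field ^ 'n \<Rightarrow> ('a ^ 'n) set" where
  "point v = vec.span {v}"

lemma mem_point: "v \<in> point v"
  by (simp add: point_def vec.span_base)

lemma subspace_point: "vec.subspace (point v)"
  by (simp add: point_def)

lemma point_subset_iff: "vec.subspace S \<Longrightarrow> point v \<subseteq> S \<longleftrightarrow> v \<in> S"
  unfolding point_def using vec.span_minimal[of "{v}" S] vec.span_base[of v "{v}"] by auto

lemma mem_pointE:
  assumes "u \<in> point v"
  obtains c where "u = c *s v"
  using assms by (auto simp: point_def vec.span_singleton)

lemma point_scale: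
  assumes "c \<noteq> 0"
  shows "point (c *s v) = point v"
proof
  show "point (c *s v) \<subseteq> point v"
    using assms mem_point[of v]
    by (simp add: point_subset_iff subspace_point subspace_scale_mem_iff)
  show "point v \<subseteq> point (c *s v)"
    using mem_point[of "c *s v"] subspace_scale_mem_iff[OF subspace_point assms]
    unfolding point_subset_iff[OF subspace_point] by blast
qed

lemma point_mem_points: "v \<noteq> 0 \<Longrightarrow> point v \<in> points"
  by (simp add: points_def point_def vec.dim_insert)

lemma eq_pointI:
  assumes "x \<in> points" "u \<in> x" "u \<noteq> 0"
  shows "x = point u"
proof (rule vec.subspace_dim_equal[symmetric])
  show subspace_x: "vec.subspace x" using assms(1) by (simp add: points_def)
  show "vec.subspace (point u)" by (rule subspace_point)
  show "point u \<subseteq> x" using point_subset_iff[OF subspace_x] assms(2) by blast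
  show "vec.dim x \<le> vec.dim (point u)"
    using assms(1) point_mem_points[OF assms(3)] by (simp add: points_def)
qed

lemma points_span_insert_diff:
  fixes p L :: "('a::field ^ 'n) set"
  assumes subspace_p: "vec.subspace p" and L: "vec.subspace L" "p \<subseteq> L" and v_notin: "v \<notin> L"
  shows "{x \<in> points. x \<subseteq> vec.span (insert v p) \<and> \<not> x \<subseteq> L} = (\<lambda>w. point (v + w)) ` p"
proof (intro equalityI subsetI)
  fix x assume x_mem: "x \<in> {x \<in> points. x \<subseteq> vec.span (insert v p) \<and> \<not> x \<subseteq> L}"
  then obtain u where u: "u \<in> x" "u \<notin> L" by blast
  then have "u \<noteq> 0" using vec.subspace_0[OF L(1)] by blast
  obtain c where remainder: "u - c *s v \<in> p"
    using x_mem u(1) mem_span_insert_iff[OF subspace_p, of u v] by blast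
  then have "c \<noteq> 0" using u(2) L(2) by auto
  have "u = c *s (v + (1 / c) *s (u - c *s v))"
    using \<open>c \<noteq> 0\<close> by (simp add: vec_eq_iff field_simps)
  then have "point u = point (v + (1 / c) *s (u - c *s v))"
    using point_scale[OF \<open>c \<noteq> 0\<close>] by metis
  moreover have "(1 / c) *s (u - c *s v) \<in> p" by (rule vec.subspace_scale[OF subspace_p remainder])
  moreover have "x = point u" using x_mem u(1) \<open>u \<noteq> 0\<close> by (intro eq_pointI) simp_all
  ultimately show "x \<in> (\<lambda>w. point (v + w)) ` p" by blast
next
  fix x assume "x \<in> (\<lambda>w. point (v + w)) ` p"
  then obtain w where w: "w \<in> p" "x = point (v + w)" by blast
  have "v + w \<notin> L"
    using v_notin w(1) L vec.subspace_diff[OF L(1), of "v + w" w] by auto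
  moreover from this have "v + w \<noteq> 0" using vec.subspace_0[OF L(1)] by metis
  moreover have "v + w \<in> vec.span (insert v p)"
    using w(1) by (intro vec.span_add) (auto intro: vec.span_base)
  ultimately show "x \<in> {x \<in> points. x \<subseteq> vec.span (insert v p) \<and> \<not> x \<subseteq> L}"
    using L(1) by (simp add: w(2) point_mem_points point_subset_iff)
qed

subsection \<open>Points of a given sign\<close>

definition of_sign :: "sign \<Rightarrow> 'a::field \<Rightarrow> bool" where
  "of_sign \<epsilon> c \<longleftrightarrow> (case \<epsilon> of Pos \<Rightarrow> c \<noteq> 0 \<and> is_square c | Neg \<Rightarrow> \<not> is_square c)"

lemma of_sign_nonzero: "of_sign \<epsilon> c \<Longrightarrow> c \<noteq> 0"
  by (cases \<epsilon>) (auto simp: of_sign_def)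

lemma of_sign_power2_mult: "a \<noteq> 0 \<Longrightarrow> of_sign \<epsilon> (a\<^sup>2 * c) \<longleftrightarrow> of_sign \<epsilon> c"
  by (cases \<epsilon>) (auto simp: of_sign_def is_square_power2_mult_iff)

lemma of_sign_ratio:
  fixes c d :: "'a::{field,finite}"
  assumes two_neq_0: "(2::'a) \<noteq> 0" and same_sign: "of_sign \<epsilon> c" "of_sign \<epsilon> d"
  obtains t where "t \<noteq> 0" "c = t\<^sup>2 * d"
proof -
  have nonzero: "c \<noteq> 0" "d \<noteq> 0" using same_sign of_sign_nonzero by blast+
  have "is_square c \<longleftrightarrow> is_square d"
    using same_sign by (cases \<epsilon>) (simp_all add: of_sign_def)
  then have "is_square (d\<^sup>2 * (c / d))"
    using is_square_mult_iff[OF two_neq_0 nonzero] nonzero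
    by (simp add: power2_eq_square mult.commute)
  then obtain t where ratio: "c / d = t\<^sup>2"
    unfolding is_square_power2_mult_iff[OF nonzero(2)] by (rule is_nth_powerE)
  show thesis
  proof
    show "t \<noteq> 0" using ratio nonzero by auto
    show "c = t\<^sup>2 * d" using ratio nonzero by (simp add: field_simps)
  qed
qed

context quadratic_space
begin

lemma point_subset_perp_iff: "point u \<subseteq> perp \<sigma> (point v) \<longleftrightarrow> u \<cdot> v = 0"
  unfolding point_subset_iff[OF subspace_perp] by (simp add: point_def perp_span mem_perp_iff)

lemma point_eq_iff:
  assumes "u \<cdot> u = e" "v \<cdot> v = e" "e \<noteq> 0"
  shows "point u = point v \<longleftrightarrow> u = v \<or> u = - v"
proof
  assume "point u = point v"
  then obtain c where multiple: "u = c *s v" using mem_point mem_pointE by metis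
  then have "c\<^sup>2 = 1" using assms by (simp add: power2_eq_square flip: mult.assoc)
  then have "c = 1 \<or> c = -1" by (simp add: power2_eq_1_iff)
  then show "u = v \<or> u = - v" using multiple by auto
next
  assume "u = v \<or> u = - v"
  then show "point u = point v" using point_scale[of "-1" v] by auto
qed

lemma card_point_image:
  assumes "e \<noteq> 0" and level: "\<And>x. x \<in> X \<Longrightarrow> x \<cdot> x = e \<and> - x \<in> X"
  shows "card X = 2 * card (point ` X)"
proof (rule card_eq_2_card_image)
  fix x assume "x \<in> X"
  have "- x \<noteq> x"
  proof
    assume "- x = x"
    then have "- (x \<cdot> x) = x \<cdot> x" by (metis bilin_minus_left)
    with level[OF \<open>x \<in> X\<close>] \<open>e \<noteq> 0\<close> show False using minus_neq_self[OF two_neq_0] by simp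
  qed
  with level[OF \<open>x \<in> X\<close>] show "- x \<in> X \<and> - x \<noteq> x" by simp
qed (use assms in \<open>auto simp: point_eq_iff\<close>)

lemma points_of_sign_eq: "points_of_sign \<sigma> \<epsilon> = point ` {v. of_sign \<epsilon> (v \<cdot> v)}"
  by (cases \<epsilon>) (auto simp: points_of_sign_def of_sign_def is_nth_power_def point_def bilin_self)

lemma of_sign_if_point_mem:
  assumes "point u \<in> points_of_sign \<sigma> \<epsilon>"
  shows "of_sign \<epsilon> (u \<cdot> u)"
proof -
  obtain v where v: "point u = point v" "of_sign \<epsilon> (v \<cdot> v)"
    using assms unfolding points_of_sign_eq by blast
  obtain c where u_eq: "u = c *s v" using v(1) mem_point mem_pointE by metis
  obtain d where v_eq: "v = d *s u" using v(1) mem_point mem_pointE by metis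
  have "c \<noteq> 0"
  proof
    assume "c = 0"
    then have "u = 0" using u_eq by simp
    then have "v = 0" using v_eq by simp
    with of_sign_nonzero[OF v(2)] show False by simp
  qed
  moreover have "u \<cdot> u = c\<^sup>2 * (v \<cdot> v)" by (simp add: u_eq power2_eq_square)
  ultimately show ?thesis using v(2) of_sign_power2_mult by metis
qed

end

locale signed_quadratic_space = quadratic_space \<sigma>
  for \<sigma> :: "'a::{field,finite} ^ 'n \<Rightarrow> 'a" +
  fixes \<epsilon> :: sign and e :: 'a
  assumes of_sign: "of_sign \<epsilon> e"
begin

abbreviation \<Gamma> :: "('a ^ 'n) set graph" where
  "\<Gamma> \<equiv> polar_graph \<sigma> \<epsilon>"

lemma e_nonzero: "e \<noteq> 0"
  by (rule of_sign_nonzero[OF of_sign])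

lemma verts_eq: "verts \<Gamma> = point ` {v. v \<cdot> v = e}"
proof -
  have "point v \<in> point ` {v. v \<cdot> v = e}" if "of_sign \<epsilon> (v \<cdot> v)" for v
  proof -
    obtain t where t: "t \<noteq> 0" "v \<cdot> v = t\<^sup>2 * e"
      using of_sign_ratio[OF two_neq_0 \<open>of_sign \<epsilon> (v \<cdot> v)\<close> of_sign] .
    have "((1 / t) *s v) \<cdot> ((1 / t) *s v) = e" using t by (simp add: power2_eq_square)
    moreover have "point v = point ((1 / t) *s v)" using point_scale[of "1 / t" v] t(1) by simp
    ultimately show ?thesis by blast
  qed
  then show ?thesis
    using of_sign by (auto simp: polar_graph_def points_of_sign_eq)
qed

lemma point_mem_verts: "v \<cdot> v = e \<Longrightarrow> point v \<in> verts \<Gamma>"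
  by (simp add: verts_eq)

lemma adj_point_iff: "adj \<Gamma> (point u) (point v) \<longleftrightarrow> u \<cdot> v = 0"
  by (simp add: polar_graph_def point_subset_perp_iff)

lemma common_nbhd_point_image: "common_nbhd \<Gamma> (point ` X) = point ` perp_level e X"
  by (auto simp: common_nbhd_def verts_eq adj_point_iff perp_level_def mem_perp_iff)

lemma inj_on_point_orthonormal:
  assumes "orthonormal e X"
  shows "inj_on point X"
proof (rule inj_onI)
  fix x y assume "x \<in> X" "y \<in> X" "point x = point y"
  then have "x = y \<or> x = - y" using assms e_nonzero by (simp add: point_eq_iff orthonormal_def)
  then have "x \<cdot> y \<noteq> 0" using assms e_nonzero \<open>y \<in> X\<close> by (auto simp: orthonormal_def)
  then show "x = y"
    using assms \<open>x \<in> X\<close> \<open>y \<in> X\<close> by (auto simp: orthonormal_def pairwise_def)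
qed

lemma clique_point_image: "orthonormal e X \<Longrightarrow> clique \<Gamma> (point ` X)"
  by (auto simp: clique_def orthonormal_def pairwise_def point_mem_verts adj_point_iff)

lemma clique_point_imageE:
  assumes "clique \<Gamma> K"
  obtains X where "orthonormal e X" "K = point ` X"
proof -
  have "K \<subseteq> point ` {v. v \<cdot> v = e}" using assms by (simp add: clique_def verts_eq)
  then obtain X where X: "X \<subseteq> {v. v \<cdot> v = e}" "inj_on point X" "K = point ` X"
    unfolding subset_image_inj by blast
  have "x \<cdot> y = 0" if "x \<in> X" "y \<in> X" "x \<noteq> y" for x y
  proof -
    have "point x \<noteq> point y" using X(2) that by (auto dest: inj_onD)
    then show ?thesis using assms that X(3) by (simp add: clique_def pairwise_def adj_point_iff)
  qed
  then have "orthonormal e X" using X(1) by (auto simp: orthonormal_def pairwise_def)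
  with X(3) show thesis by (rule that[rotated])
qed

lemma card_common_nbhd_point_image:
  "2 * card (common_nbhd \<Gamma> (point ` X)) = card (perp_level e X)"
  unfolding common_nbhd_point_image
  using card_point_image[OF e_nonzero, of "perp_level e X"]
  by (simp add: perp_level_def mem_perp_iff)

lemma card_common_nbhd_clique_eq:
  assumes "clique \<Gamma> K" "clique \<Gamma> K'" "card K = card K'"
  shows "card (common_nbhd \<Gamma> K) = card (common_nbhd \<Gamma> K')"
proof -
  obtain X where X: "orthonormal e X" "K = point ` X" using assms(1) by (rule clique_point_imageE)
  obtain Y where Y: "orthonormal e Y" "K' = point ` Y" using assms(2) by (rule clique_point_imageE)
  have "card X = card Y"
    using assms(3) X Y by (simp add: card_image inj_on_point_orthonormal)
  then have "card (perp_level e X) = card (perp_level e Y)"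
    by (rule card_perp_level_eq[OF e_nonzero X(1) Y(1)])
  then show ?thesis
    unfolding X(2) Y(2) by (simp flip: card_common_nbhd_point_image)
qed

lemma not_graph_iso_if_clique:
  assumes "clique G K" "clique \<Gamma> K'" "card K = card K'"
    and "card (common_nbhd G K) \<noteq> card (common_nbhd \<Gamma> K')"
  shows "\<not> graph_iso G \<Gamma>"
proof
  assume "graph_iso G \<Gamma>"
  then obtain K'' where "clique \<Gamma> K''" "card K'' = card K"
    "card (common_nbhd \<Gamma> K'') = card (common_nbhd G K)"
    using assms(1) by (rule graph_iso_clique)
  with assms(2-4) card_common_nbhd_clique_eq[of K'' K'] show False by simp
qed

end

subsection \<open>The switching set\<close>

locale isotropic_subspace = signed_quadratic_space \<sigma> \<epsilon> e
  for \<sigma> :: "'a::{field,finite} ^ 'n \<Rightarrow> 'a" and \<epsilon> e +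
  fixes p :: "('a ^ 'n) set"
  assumes subspace_p: "vec.subspace p"
    and isotropic_p: "totally_isotropic \<sigma> p"
begin

definition tangent :: "'a ^ 'n \<Rightarrow> bool" where
  "tangent v \<longleftrightarrow> v \<cdot> v = e \<and> v \<in> perp \<sigma> p"

definition tangent_points :: "'a ^ 'n \<Rightarrow> ('a ^ 'n) set set" where
  "tangent_points v = (\<lambda>w. point (v + w)) ` p"

lemma zero_mem_p: "0 \<in> p"
  by (rule vec.subspace_0[OF subspace_p])

lemma p_subset_perp: "p \<subseteq> perp \<sigma> p"
  using isotropic_p by (simp add: totally_isotropic_def)

lemma point_mem_tangent_points: "point v \<in> tangent_points v"
  unfolding tangent_points_def using zero_mem_p by force

lemma tangent_add:
  assumes "tangent v" "w \<in> p"
  shows "tangent (v + w)"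
proof -
  have "w \<in> perp \<sigma> p" using assms(2) p_subset_perp by blast
  then have "v \<cdot> w = 0" "w \<cdot> v = 0" "w \<cdot> w = 0" "v + w \<in> perp \<sigma> p"
    using assms vec.subspace_add[OF subspace_perp] by (auto simp: tangent_def dest: perpD)
  then show ?thesis using assms(1) by (simp add: tangent_def)
qed

lemma tangent_points_subset_verts: "tangent v \<Longrightarrow> tangent_points v \<subseteq> verts \<Gamma>"
  using tangent_add by (auto simp: tangent_points_def tangent_def intro: point_mem_verts)

lemma inj_on_tangent_points:
  assumes "tangent v"
  shows "inj_on (\<lambda>w. point (v + w)) p"
proof (rule inj_onI)
  fix w w' assume mem_p: "w \<in> p" "w' \<in> p" and "point (v + w) = point (v + w')"
  then have "v + w = v + w' \<or> v + w = - (v + w')"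
    using mem_p tangent_add[OF assms] e_nonzero by (simp add: tangent_def point_eq_iff)
  moreover have "v + w \<noteq> - (v + w')"
  proof
    assume "v + w = - (v + w')"
    then have "(v + w) \<cdot> v = (- (v + w')) \<cdot> v" by (rule arg_cong)
    moreover have "w \<cdot> v = 0" "w' \<cdot> v = 0"
      using assms mem_p by (auto simp: tangent_def dest: perpD)
    ultimately have "- e = e" using assms by (simp add: tangent_def)
    with minus_neq_self[OF two_neq_0 e_nonzero] show False by simp
  qed
  ultimately show "w = w'" by simp
qed

lemma card_tangent_points: "tangent v \<Longrightarrow> card (tangent_points v) = card p"
  unfolding tangent_points_def by (rule card_image[OF inj_on_tangent_points])

lemma tangent_pointsE:
  assumes "point u \<in> tangent_points v" "tangent v" "u \<cdot> u = e"
  obtains w where "w \<in> p" "u = v + w \<or> u = - (v + w)"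
proof -
  obtain w where w: "w \<in> p" "point u = point (v + w)"
    using assms(1) unfolding tangent_points_def by blast
  have "u = v + w \<or> u = - (v + w)"
    using tangent_add[OF assms(2) w(1)] assms(3) w(2) e_nonzero
    by (simp add: tangent_def point_eq_iff)
  with w(1) show thesis by (rule that)
qed

lemma mem_perp_if_tangent_point:
  assumes "point u \<in> tangent_points v" "tangent v" "u \<cdot> u = e"
  shows "u \<in> perp \<sigma> p"
proof -
  obtain w where w: "w \<in> p" "u = v + w \<or> u = - (v + w)" using assms by (rule tangent_pointsE)
  have "v + w \<in> perp \<sigma> p" using tangent_add[OF assms(2) w(1)] by (simp add: tangent_def)
  with w(2) show ?thesis using vec.subspace_neg[OF subspace_perp] by metis
qed

lemma tangent_point_bilin_eq_0_iff:
  assumes "point u \<in> tangent_points v" "tangent v" "u \<cdot> u = e" and "x \<in> perp \<sigma> p"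
  shows "u \<cdot> x = 0 \<longleftrightarrow> v \<cdot> x = 0"
proof -
  obtain w where w: "w \<in> p" "u = v + w \<or> u = - (v + w)" using assms(1-3) by (rule tangent_pointsE)
  have "w \<cdot> x = 0" using assms(4) w(1) by (rule perpD(2))
  with w(2) show ?thesis by auto
qed

lemma nbhd_tangent_points:
  assumes "tangent v"
  shows "nbhd \<Gamma> (point u) \<inter> tangent_points v = (\<lambda>w. point (v + w)) ` {w \<in> p. u \<cdot> (v + w) = 0}"
proof -
  have "nbhd \<Gamma> (point u) \<inter> tangent_points v = {x \<in> tangent_points v. adj \<Gamma> (point u) x}"
    using tangent_points_subset_verts[OF assms] by (auto simp: nbhd_def)
  then show ?thesis by (auto simp: tangent_points_def adj_point_iff)
qed

lemma card_nbhd_tangent_points: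
  assumes "tangent v"
  shows "card (nbhd \<Gamma> (point u) \<inter> tangent_points v) = card {w \<in> p. u \<cdot> (v + w) = 0}"
  unfolding nbhd_tangent_points[OF assms]
  by (rule card_image, rule inj_on_subset[OF inj_on_tangent_points[OF assms]]) blast

lemma nbhd_tangent_points_perp:
  assumes "tangent v" "u \<in> perp \<sigma> p"
  shows "nbhd \<Gamma> (point u) \<inter> tangent_points v = (if u \<cdot> v = 0 then tangent_points v else {})"
  unfolding nbhd_tangent_points[OF assms(1)] using perpD(1)[OF assms(2)]
  by (auto simp: tangent_points_def)

lemma nbhd_tangent_points_not_perp:
  assumes tangent: "tangent v" "tangent v'" and "u \<notin> perp \<sigma> p"
  shows "card (nbhd \<Gamma> (point u) \<inter> tangent_points v)
      = card (nbhd \<Gamma> (point u) \<inter> tangent_points v')"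
    and "nbhd \<Gamma> (point u) \<inter> tangent_points v \<noteq> {}"
proof -
  obtain w where w: "w \<in> p" "u \<cdot> w \<noteq> 0" using assms(3) by (auto simp: mem_perp_iff)
  have surjective: "\<exists>t\<in>p. u \<cdot> t = c" for c
    using vec.subspace_scale[OF subspace_p w(1), of "c / (u \<cdot> w)"] w(2)
    by (intro bexI[of _ "(c / (u \<cdot> w)) *s w"]) simp_all
  then obtain t where t: "t \<in> p" "u \<cdot> t = u \<cdot> v - u \<cdot> v'" by blast
  have "bij_betw (\<lambda>w. w + t) {w \<in> p. u \<cdot> (v + w) = 0} {w \<in> p. u \<cdot> (v' + w) = 0}"
    using t(1) vec.subspace_add[OF subspace_p] vec.subspace_diff[OF subspace_p]
    by (intro bij_betw_byWitness[where f' = "\<lambda>w. w - t"]) (auto simp: t(2) add_eq_0_iff)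
  then show "card (nbhd \<Gamma> (point u) \<inter> tangent_points v)
      = card (nbhd \<Gamma> (point u) \<inter> tangent_points v')"
    using tangent by (simp only: card_nbhd_tangent_points bij_betw_same_card)
  obtain t' where "t' \<in> p" "u \<cdot> t' = - (u \<cdot> v)" using surjective by blast
  then show "nbhd \<Gamma> (point u) \<inter> tangent_points v \<noteq> {}"
    unfolding nbhd_tangent_points[OF tangent(1)] by auto
qed

lemma tangent_add_bilin: "w \<in> p \<Longrightarrow> x \<in> perp \<sigma> p \<Longrightarrow> (v + w) \<cdot> x = v \<cdot> x"
  using perpD(2)[of x p w] by simp

lemma induced_regular_tangent_points:
  assumes "tangent v"
  shows "induced_regular \<Gamma> (tangent_points v) 0"
  unfolding induced_regular_def
proof
  fix x assume "x \<in> tangent_points v"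
  then obtain w where w: "w \<in> p" "x = point (v + w)" by (auto simp: tangent_points_def)
  have "(v + w) \<cdot> v = e" using assms tangent_add_bilin[OF w(1)] by (simp add: tangent_def)
  moreover have "v + w \<in> perp \<sigma> p" using tangent_add[OF assms w(1)] by (simp add: tangent_def)
  ultimately show "card (nbhd \<Gamma> x \<inter> tangent_points v) = 0"
    using assms e_nonzero by (simp add: w(2) nbhd_tangent_points_perp del: bilin_add_left)
qed

end

locale switching_pair = isotropic_subspace \<sigma> \<epsilon> e p
  for \<sigma> :: "'a::{field,finite} ^ 'n \<Rightarrow> 'a" and \<epsilon> e p +
  fixes v\<^sub>1 v\<^sub>2 :: "'a ^ 'n"
  assumes tangent: "tangent v\<^sub>1" "tangent v\<^sub>2"
    and independent: "\<And>c d. c *s v\<^sub>1 + d *s v\<^sub>2 \<in> p \<Longrightarrow> c = 0 \<and> d = 0"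
begin

abbreviation C\<^sub>1 :: "('a ^ 'n) set set" where "C\<^sub>1 \<equiv> tangent_points v\<^sub>1"

abbreviation C\<^sub>2 :: "('a ^ 'n) set set" where "C\<^sub>2 \<equiv> tangent_points v\<^sub>2"

abbreviation \<Gamma>' :: "('a ^ 'n) set graph" where "\<Gamma>' \<equiv> switch \<Gamma> C\<^sub>1 C\<^sub>2"

lemma tangent_vectors: "v\<^sub>1 \<cdot> v\<^sub>1 = e" "v\<^sub>2 \<cdot> v\<^sub>2 = e" "v\<^sub>1 \<in> perp \<sigma> p" "v\<^sub>2 \<in> perp \<sigma> p"
  using tangent by (simp_all add: tangent_def)

lemma C_disjoint: "C\<^sub>1 \<inter> C\<^sub>2 = {}"
proof -
  have "point (v\<^sub>1 + w) \<notin> C\<^sub>2" if "w \<in> p" for w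
  proof
    assume "point (v\<^sub>1 + w) \<in> C\<^sub>2"
    moreover have "(v\<^sub>1 + w) \<cdot> (v\<^sub>1 + w) = e"
      using tangent_add[OF tangent(1) \<open>w \<in> p\<close>] unfolding tangent_def by blast
    ultimately obtain w' where w': "w' \<in> p" "v\<^sub>1 + w = v\<^sub>2 + w' \<or> v\<^sub>1 + w = - (v\<^sub>2 + w')"
      by (rule tangent_pointsE[OF _ tangent(2)])
    from w'(2) obtain s where "v\<^sub>1 + w = s *s (v\<^sub>2 + w')"
      by (metis scaleR_one vector_smult_lid vector_sneg_minus1)
    then have "1 *s v\<^sub>1 + (- s) *s v\<^sub>2 = s *s w' - w" by (simp add: vec_eq_iff algebra_simps)
    moreover have "s *s w' - w \<in> p"
      by (intro vec.subspace_diff vec.subspace_scale subspace_p w'(1) \<open>w \<in> p\<close>)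
    ultimately show False using independent[of 1 "- s"] by simp
  qed
  then show ?thesis by (auto simp: tangent_points_def[of v\<^sub>1])
qed

lemma card_nbhd_Un:
  assumes "u \<in> perp \<sigma> p"
  shows "card (nbhd \<Gamma> (point u) \<inter> (C\<^sub>1 \<union> C\<^sub>2))
    = (if u \<cdot> v\<^sub>1 = 0 then card p else 0) + (if u \<cdot> v\<^sub>2 = 0 then card p else 0)"
proof -
  have "card (nbhd \<Gamma> (point u) \<inter> (C\<^sub>1 \<union> C\<^sub>2))
    = card (nbhd \<Gamma> (point u) \<inter> C\<^sub>1) + card (nbhd \<Gamma> (point u) \<inter> C\<^sub>2)"
    unfolding Int_Un_distrib using C_disjoint by (intro card_Un_disjoint) auto
  then show ?thesis
    using assms tangent by (simp add: nbhd_tangent_points_perp card_tangent_points)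
qed

lemma induced_regular_C_Un:
  "induced_regular \<Gamma> (C\<^sub>1 \<union> C\<^sub>2) (if v\<^sub>1 \<cdot> v\<^sub>2 = 0 then card p else 0)"
  unfolding induced_regular_def
proof
  fix x assume "x \<in> C\<^sub>1 \<union> C\<^sub>2"
  then obtain v w where x: "v \<in> {v\<^sub>1, v\<^sub>2}" "w \<in> p" "x = point (v + w)"
    by (auto simp: tangent_points_def)
  have "tangent v" using x(1) tangent by blast
  then have "v + w \<in> perp \<sigma> p" using tangent_add x(2) by (simp add: tangent_def)
  moreover have "(v + w) \<cdot> v\<^sub>1 = v \<cdot> v\<^sub>1" "(v + w) \<cdot> v\<^sub>2 = v \<cdot> v\<^sub>2"
    using tangent_add_bilin[OF x(2)] tangent_vectors(3,4) by blast+
  ultimately show "card (nbhd \<Gamma> x \<inter> (C\<^sub>1 \<union> C\<^sub>2)) = (if v\<^sub>1 \<cdot> v\<^sub>2 = 0 then card p else 0)"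
    using x(1) tangent_vectors(1,2) e_nonzero bilin_commute[of v\<^sub>2 v\<^sub>1]
    by (auto simp: x(3) card_nbhd_Un simp del: bilin_add_left)
qed

theorem switching_set_tangent_points: "switching_set \<Gamma> C\<^sub>1 C\<^sub>2"
  unfolding switching_set_def
proof (intro conjI)
  show "finite (verts \<Gamma>)" by simp
  show "C\<^sub>1 \<subseteq> verts \<Gamma>" "C\<^sub>2 \<subseteq> verts \<Gamma>" using tangent tangent_points_subset_verts by blast+
  show "C\<^sub>1 \<inter> C\<^sub>2 = {}" by (rule C_disjoint)
  show card_eq: "card C\<^sub>1 = card C\<^sub>2"
    using tangent by (simp add: card_tangent_points)
  show "\<exists>k. induced_regular \<Gamma> C\<^sub>1 k \<and> induced_regular \<Gamma> C\<^sub>2 k"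
    "\<exists>l. induced_regular \<Gamma> (C\<^sub>1 \<union> C\<^sub>2) l"
    using induced_regular_tangent_points tangent induced_regular_C_Un by blast+
  show "\<forall>x\<in>verts \<Gamma> - (C\<^sub>1 \<union> C\<^sub>2).
      card (nbhd \<Gamma> x \<inter> C\<^sub>1) = card (nbhd \<Gamma> x \<inter> C\<^sub>2) \<or> nbhd \<Gamma> x \<inter> (C\<^sub>1 \<union> C\<^sub>2) \<in> {C\<^sub>1, C\<^sub>2}"
  proof
    fix x assume "x \<in> verts \<Gamma> - (C\<^sub>1 \<union> C\<^sub>2)"
    then obtain u where x_eq: "x = point u" by (auto simp: verts_eq)
    show "card (nbhd \<Gamma> x \<inter> C\<^sub>1) = card (nbhd \<Gamma> x \<inter> C\<^sub>2) \<or> nbhd \<Gamma> x \<inter> (C\<^sub>1 \<union> C\<^sub>2) \<in> {C\<^sub>1, C\<^sub>2}"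
    proof (cases "u \<in> perp \<sigma> p")
      case True
      then show ?thesis
        using card_eq tangent by (simp add: x_eq Int_Un_distrib nbhd_tangent_points_perp)
    next
      case False
      then show ?thesis unfolding x_eq using nbhd_tangent_points_not_perp(1)[OF tangent] by blast
    qed
  qed
qed

lemma switched_nbhd_perp:
  assumes "u \<in> perp \<sigma> p"
  shows "switched_nbhd \<Gamma> C\<^sub>1 C\<^sub>2 (point u)
    = (if u \<cdot> v\<^sub>2 = 0 then C\<^sub>1 else {}) \<union> (if u \<cdot> v\<^sub>1 = 0 then C\<^sub>2 else {})"
proof (rule switched_nbhd_swap[OF _ _ _ C_disjoint])
  show "nbhd \<Gamma> (point u) \<inter> (C\<^sub>1 \<union> C\<^sub>2)
    = (if u \<cdot> v\<^sub>1 = 0 then C\<^sub>1 else {}) \<union> (if u \<cdot> v\<^sub>2 = 0 then C\<^sub>2 else {})"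
    unfolding Int_Un_distrib using assms tangent by (simp add: nbhd_tangent_points_perp)
qed (use point_mem_tangent_points in blast)+

lemma switched_nbhd_not_perp:
  assumes "u \<notin> perp \<sigma> p"
  shows "switched_nbhd \<Gamma> C\<^sub>1 C\<^sub>2 (point u) = nbhd \<Gamma> (point u) \<inter> (C\<^sub>1 \<union> C\<^sub>2)"
proof (rule switched_nbhd_unchanged)
  have "nbhd \<Gamma> (point u) \<inter> C\<^sub>1 \<noteq> {}" "nbhd \<Gamma> (point u) \<inter> C\<^sub>2 \<noteq> {}"
    using nbhd_tangent_points_not_perp(2) tangent assms by blast+
  then show "nbhd \<Gamma> (point u) \<inter> (C\<^sub>1 \<union> C\<^sub>2) \<notin> {C\<^sub>1, C\<^sub>2}" using C_disjoint by blast
qed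

lemma adj_switch_v\<^sub>1:
  assumes "u \<cdot> u = e" "point u \<notin> C\<^sub>1 \<union> C\<^sub>2"
  shows "adj \<Gamma>' (point u) (point v\<^sub>1) \<longleftrightarrow> (if u \<in> perp \<sigma> p then u \<cdot> v\<^sub>2 = 0 else u \<cdot> v\<^sub>1 = 0)"
    and "adj \<Gamma>' (point v\<^sub>1) (point u) \<longleftrightarrow> (if u \<in> perp \<sigma> p then u \<cdot> v\<^sub>2 = 0 else u \<cdot> v\<^sub>1 = 0)"
proof -
  have v\<^sub>1: "point v\<^sub>1 \<in> C\<^sub>1" "point v\<^sub>1 \<notin> C\<^sub>2" "point v\<^sub>1 \<in> verts \<Gamma>"
    using point_mem_tangent_points C_disjoint tangent_vectors(1) point_mem_verts by blast+
  have "point v\<^sub>1 \<in> switched_nbhd \<Gamma> C\<^sub>1 C\<^sub>2 (point u)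
      \<longleftrightarrow> (if u \<in> perp \<sigma> p then u \<cdot> v\<^sub>2 = 0 else u \<cdot> v\<^sub>1 = 0)"
    using v\<^sub>1 by (simp add: switched_nbhd_perp switched_nbhd_not_perp nbhd_def adj_point_iff)
  moreover have "point u \<in> verts \<Gamma> - (C\<^sub>1 \<union> C\<^sub>2)" using assms point_mem_verts by blast
  ultimately show
    "adj \<Gamma>' (point u) (point v\<^sub>1) \<longleftrightarrow> (if u \<in> perp \<sigma> p then u \<cdot> v\<^sub>2 = 0 else u \<cdot> v\<^sub>1 = 0)"
    "adj \<Gamma>' (point v\<^sub>1) (point u) \<longleftrightarrow> (if u \<in> perp \<sigma> p then u \<cdot> v\<^sub>2 = 0 else u \<cdot> v\<^sub>1 = 0)"
    using v\<^sub>1(1) by (simp_all add: adj_switch_across)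
qed

end

locale switching_clique = switching_pair \<sigma> \<epsilon> e p v\<^sub>1 v\<^sub>2
  for \<sigma> :: "'a::{field,finite} ^ 'n \<Rightarrow> 'a" and \<epsilon> e p v\<^sub>1 v\<^sub>2 +
  fixes K :: "('a ^ 'n) set" and k\<^sub>0 :: "'a ^ 'n"
  assumes orthonormal_K: "orthonormal e K"
    and K_perp_v\<^sub>2: "\<And>k. k \<in> K \<Longrightarrow> k \<cdot> v\<^sub>2 = 0"
    and K_perp_v\<^sub>1: "\<And>k. k \<in> K \<Longrightarrow> k \<notin> perp \<sigma> p \<Longrightarrow> k \<cdot> v\<^sub>1 = 0"
    and K_notin_C\<^sub>1: "\<And>k. k \<in> K \<Longrightarrow> point k \<notin> C\<^sub>1"
    and k\<^sub>0: "k\<^sub>0 \<in> K" "k\<^sub>0 \<in> perp \<sigma> p" "k\<^sub>0 \<cdot> v\<^sub>1 \<noteq> 0"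
begin

lemma K_norm: "k \<in> K \<Longrightarrow> k \<cdot> k = e"
  using orthonormal_K by (simp add: orthonormal_def)

lemma K_outside:
  assumes "k \<in> K"
  shows "point k \<notin> C\<^sub>1 \<union> C\<^sub>2"
proof
  assume "point k \<in> C\<^sub>1 \<union> C\<^sub>2"
  then have "point k \<in> C\<^sub>2" using K_notin_C\<^sub>1[OF assms] by blast
  from tangent_point_bilin_eq_0_iff[OF this tangent(2) K_norm[OF assms] tangent_vectors(4)]
  show False using K_perp_v\<^sub>2[OF assms] tangent_vectors(2) e_nonzero by simp
qed

lemma adj_switch_K: "k \<in> K \<Longrightarrow> l \<in> K \<Longrightarrow> adj \<Gamma>' (point k) (point l) \<longleftrightarrow> k \<cdot> l = 0"
  using adj_switch_same_side[of "point k" C\<^sub>1 C\<^sub>2 "point l" \<Gamma>] K_outside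
  by (simp add: adj_point_iff)

lemma clique_switch: "clique \<Gamma>' (insert (point v\<^sub>1) (point ` K))"
proof -
  have "pairwise (adj \<Gamma>') (point ` K)"
    using orthonormal_K
    by (intro pairwise_imageI) (auto simp: adj_switch_K orthonormal_def pairwise_def)
  moreover have "adj \<Gamma>' (point v\<^sub>1) (point k)" "adj \<Gamma>' (point k) (point v\<^sub>1)" if "k \<in> K" for k
    using adj_switch_v\<^sub>1[OF K_norm K_outside] K_perp_v\<^sub>1 K_perp_v\<^sub>2 that by simp_all
  ultimately show ?thesis
    using K_norm tangent_vectors(1) point_mem_verts by (auto simp: clique_def pairwise_insert)
qed

definition switched_level :: "('a ^ 'n) set" where
  "switched_level = {u \<in> perp_level e K. if u \<in> perp \<sigma> p then u \<cdot> v\<^sub>2 = 0 else u \<cdot> v\<^sub>1 = 0}"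

lemma not_common_nbhd_inside:
  assumes u: "u \<cdot> u = e" "point u \<in> C\<^sub>1 \<union> C\<^sub>2"
  shows "point u \<notin> common_nbhd \<Gamma>' (insert (point v\<^sub>1) (point ` K))" and "u \<notin> switched_level"
proof -
  have "\<not> adj \<Gamma>' (point u) (point v\<^sub>1) \<and> u \<cdot> k\<^sub>0 \<noteq> 0" if "point u \<in> C\<^sub>1"
  proof
    have "u \<cdot> v\<^sub>1 \<noteq> 0"
      using tangent_point_bilin_eq_0_iff[OF that tangent(1) u(1) tangent_vectors(3)]
        tangent_vectors(1) e_nonzero by simp
    then show "\<not> adj \<Gamma>' (point u) (point v\<^sub>1)"
      using u(2) point_mem_tangent_points[of v\<^sub>1] by (simp add: adj_switch_same_side adj_point_iff)
    show "u \<cdot> k\<^sub>0 \<noteq> 0"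
      using tangent_point_bilin_eq_0_iff[OF that tangent(1) u(1) k\<^sub>0(2)] k\<^sub>0(3)
        bilin_commute[of v\<^sub>1] by simp
  qed
  moreover have "\<not> adj \<Gamma>' (point u) (point k\<^sub>0) \<and> u \<in> perp \<sigma> p \<and> u \<cdot> v\<^sub>2 \<noteq> 0" if "point u \<in> C\<^sub>2"
  proof (intro conjI)
    have "point k\<^sub>0 \<in> verts \<Gamma> - (C\<^sub>1 \<union> C\<^sub>2)"
      using K_norm[OF k\<^sub>0(1)] K_outside[OF k\<^sub>0(1)] point_mem_verts by blast
    moreover have "switched_nbhd \<Gamma> C\<^sub>1 C\<^sub>2 (point k\<^sub>0) = C\<^sub>1"
      using switched_nbhd_perp[OF k\<^sub>0(2)] k\<^sub>0(3) K_perp_v\<^sub>2[OF k\<^sub>0(1)] by simp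
    ultimately have "adj \<Gamma>' (point u) (point k\<^sub>0) \<longleftrightarrow> point u \<in> C\<^sub>1"
      using adj_switch_across(2)[OF _ u(2)] by simp
    then show "\<not> adj \<Gamma>' (point u) (point k\<^sub>0)" using that C_disjoint by blast
    show "u \<in> perp \<sigma> p" by (rule mem_perp_if_tangent_point[OF that tangent(2) u(1)])
    show "u \<cdot> v\<^sub>2 \<noteq> 0"
      using tangent_point_bilin_eq_0_iff[OF that tangent(2) u(1) tangent_vectors(4)]
        tangent_vectors(2) e_nonzero by simp
  qed
  ultimately show "point u \<notin> common_nbhd \<Gamma>' (insert (point v\<^sub>1) (point ` K))" "u \<notin> switched_level"
    using u(2) k\<^sub>0(1) by (auto simp: common_nbhd_def switched_level_def perp_level_def mem_perp_iff)
qed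

lemma common_nbhd_switch:
  "common_nbhd \<Gamma>' (insert (point v\<^sub>1) (point ` K)) = point ` switched_level"
proof -
  have "point u \<in> common_nbhd \<Gamma>' (insert (point v\<^sub>1) (point ` K)) \<longleftrightarrow> u \<in> switched_level"
    if u: "u \<cdot> u = e" for u
  proof (cases "point u \<in> C\<^sub>1 \<union> C\<^sub>2")
    case True
    then show ?thesis using not_common_nbhd_inside[OF u] by blast
  next
    case False
    have "adj \<Gamma>' (point u) (point k) \<longleftrightarrow> u \<cdot> k = 0" if "k \<in> K" for k
      using adj_switch_same_side[of "point u" C\<^sub>1 C\<^sub>2 "point k" \<Gamma>] False K_outside[OF that]
      by (simp add: adj_point_iff)
    then show ?thesis
      using u point_mem_verts[OF u] adj_switch_v\<^sub>1(1)[OF u False]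
      by (auto simp: common_nbhd_def switched_level_def perp_level_def mem_perp_iff)
  qed
  moreover have "common_nbhd \<Gamma>' (insert (point v\<^sub>1) (point ` K)) \<subseteq> point ` {u. u \<cdot> u = e}"
    by (auto simp: common_nbhd_def verts_eq)
  moreover have "switched_level \<subseteq> {u. u \<cdot> u = e}"
    by (auto simp: switched_level_def perp_level_def)
  ultimately show ?thesis by blast
qed

lemma not_graph_iso_switch:
  assumes "card {u \<in> perp_level e K. u \<notin> perp \<sigma> p \<and> u \<cdot> v\<^sub>1 = 0}
    \<noteq> card {u \<in> perp_level e K. u \<notin> perp \<sigma> p \<and> u \<cdot> v\<^sub>2 = 0}"
  shows "\<not> graph_iso \<Gamma>' \<Gamma>"
proof (rule not_graph_iso_if_clique[OF clique_switch])
  have "v\<^sub>2 \<in> perp \<sigma> K" using K_perp_v\<^sub>2 by (metis bilin_commute mem_perp_iff)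
  then have v\<^sub>2K: "orthonormal e (insert v\<^sub>2 K)"
    using orthonormal_K tangent_vectors(2) by (simp add: orthonormal_insert)
  show "clique \<Gamma> (point ` insert v\<^sub>2 K)" by (rule clique_point_image[OF v\<^sub>2K])
  have "point v\<^sub>1 \<notin> point ` K"
    using K_outside point_mem_tangent_points by (metis UnI1 imageE)
  moreover have "v\<^sub>2 \<notin> K" using K_perp_v\<^sub>2 tangent_vectors(2) e_nonzero by auto
  ultimately show "card (insert (point v\<^sub>1) (point ` K)) = card (point ` insert v\<^sub>2 K)"
    using inj_on_point_orthonormal[OF orthonormal_K] inj_on_point_orthonormal[OF v\<^sub>2K]
    by (simp add: card_image del: image_insert)
  have "card switched_level = 2 * card (point ` switched_level)"
    using e_nonzero
    by (intro card_point_image[of e]) (simp_all add: switched_level_def perp_level_def mem_perp_iff)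
  moreover have "card switched_level
      = card {u \<in> perp_level e K. u \<in> perp \<sigma> p \<and> u \<cdot> v\<^sub>2 = 0}
      + card {u \<in> perp_level e K. u \<notin> perp \<sigma> p \<and> u \<cdot> v\<^sub>1 = 0}"
    by (subst card_Un_disjoint[symmetric])
      (auto simp: switched_level_def intro!: arg_cong[of _ _ card])
  moreover have "card (perp_level e (insert v\<^sub>2 K))
      = card {u \<in> perp_level e K. u \<in> perp \<sigma> p \<and> u \<cdot> v\<^sub>2 = 0}
      + card {u \<in> perp_level e K. u \<notin> perp \<sigma> p \<and> u \<cdot> v\<^sub>2 = 0}"
    by (subst card_Un_disjoint[symmetric])
      (auto simp: perp_level_def mem_perp_iff intro!: arg_cong[of _ _ card])
  ultimately show "card (common_nbhd \<Gamma>' (insert (point v\<^sub>1) (point ` K)))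
      \<noteq> card (common_nbhd \<Gamma> (point ` insert v\<^sub>2 K))"
    using assms card_common_nbhd_point_image[of "insert v\<^sub>2 K"] by (simp only: common_nbhd_switch)
qed

end

subsection \<open>A clique with the wrong number of common neighbours\<close>

context quadratic_space
begin

lemma prescribed_component:
  assumes orth: "orthogonal_system X" and v: "v \<in> perp \<sigma> X" "v \<cdot> v \<noteq> 0"
    and "c \<noteq> 0" "c \<noteq> 1" "e \<noteq> 0" and card: "2 \<le> k" "card X + k + 1 < CARD('n)"
  obtains w Y where "w \<in> perp \<sigma> X" "w \<cdot> w = c * (v \<cdot> v)" "w \<cdot> v = c * (v \<cdot> v)"
    "Y \<subseteq> perp \<sigma> (insert w X)" "orthonormal e Y" "card Y = k" "v - w \<in> vec.span Y"
proof -
  have "card X + 3 \<le> CARD('n)" using card by simp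
  then obtain w where w: "w \<in> perp \<sigma> X" "w \<cdot> w = c * (v \<cdot> v)" "w \<cdot> v = c * (v \<cdot> v)"
    using orth v by (metis perp_component)
  have orth_w: "orthogonal_system (insert w X)"
    using orth w(1,2) \<open>c \<noteq> 0\<close> v(2) by (simp add: orthogonal_system_insert)
  have "v - w \<in> perp \<sigma> (insert w X)"
    using v(1) w by (simp add: mem_perp_iff bilin_commute[of v w])
  moreover have "(v - w) \<cdot> (v - w) = (1 - c) * (v \<cdot> v)"
    using w(2,3) by (simp add: bilin_commute[of v w] algebra_simps)
  then have "(v - w) \<cdot> (v - w) \<noteq> 0" using \<open>c \<noteq> 1\<close> v(2) by simp
  moreover have "card (insert w X) + k < CARD('n)" using card(2) by (simp add: card_insert_if)
  ultimately obtain Y where "Y \<subseteq> perp \<sigma> (insert w X)" "orthonormal e Y" "card Y = k"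
    "v - w \<in> vec.span Y"
    using orthonormal_spanning_vector[OF orth_w _ _ \<open>e \<noteq> 0\<close> card(1)] by blast
  with w show thesis by (rule that)
qed

lemma prescribed_component_basis:
  assumes orth: "orthogonal_system X" and v: "v \<in> perp \<sigma> X" "v \<cdot> v \<noteq> 0"
    and "c \<noteq> 0" "c \<noteq> 1" "e \<noteq> 0" and card: "2 \<le> k" "card X + k + 2 = CARD('n)"
  obtains w s Y where "w \<cdot> w = c * (v \<cdot> v)" "w \<cdot> v = c * (v \<cdot> v)"
    "orthonormal e Y" "card Y = k" "v - w \<in> vec.span Y"
    "orthogonal_system (X \<union> {w, s} \<union> Y)" "card (X \<union> {w, s} \<union> Y) = CARD('n)"
proof -
  have "card X + k + 1 < CARD('n)" using card(2) by simp
  then obtain w Y where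
    w: "w \<in> perp \<sigma> X" "w \<cdot> w = c * (v \<cdot> v)" "w \<cdot> v = c * (v \<cdot> v)" and
    Y: "Y \<subseteq> perp \<sigma> (insert w X)" "orthonormal e Y" "card Y = k" "v - w \<in> vec.span Y"
    using prescribed_component[OF orth v \<open>c \<noteq> 0\<close> \<open>c \<noteq> 1\<close> \<open>e \<noteq> 0\<close> card(1)] by metis
  have "w \<cdot> w \<noteq> 0" using w(2) \<open>c \<noteq> 0\<close> v(2) by simp
  then have "w \<notin> X" and orth_w: "orthogonal_system (insert w X)"
    using nonsingular_perp_notin orthogonal_system_insert orth w(1) by blast+
  have orth_Y: "orthogonal_system Y" using Y(2) \<open>e \<noteq> 0\<close> by (rule orthogonal_system_if_orthonormal)
  have "insert w X \<inter> Y = {}" using orth_Y Y(1) by (rule disjoint_if_subset_perp)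
  then have card_wY: "card (insert w X \<union> Y) + 1 = CARD('n)"
    using \<open>w \<notin> X\<close> Y(3) card(2) by (simp only: card_Un_disjoint finite card_insert_disjoint) simp
  have orth_wY: "orthogonal_system (insert w X \<union> Y)"
    using orth_w orth_Y Y(1) by (rule orthogonal_system_Un)
  obtain s where s: "s \<in> perp \<sigma> (insert w X \<union> Y)" "s \<cdot> s \<noteq> 0"
    using perp_nonsingular[OF orth_wY] card_wY by auto
  have basis_eq: "X \<union> {w, s} \<union> Y = insert s (insert w X \<union> Y)" by auto
  have "s \<notin> insert w X \<union> Y" using s by (rule nonsingular_perp_notin)
  then have "card (X \<union> {w, s} \<union> Y) = CARD('n)" unfolding basis_eq using card_wY by simp
  moreover have "orthogonal_system (X \<union> {w, s} \<union> Y)"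
    unfolding basis_eq using orth_wY s by (rule orthogonal_system_insert)
  ultimately show thesis using that w(2,3) Y(2-4) by blast
qed

text \<open>A frame is two vectors short of an orthogonal basis. They are left free because the cliques
  in the graph and in the switched graph use different vectors of the plane that is perpendicular
  to the frame.\<close>

definition hyperbolic_frame ::
  "'a \<Rightarrow> 'a ^ 'n \<Rightarrow> 'a ^ 'n \<Rightarrow> 'a ^ 'n \<Rightarrow> ('a ^ 'n) set \<Rightarrow> bool" where
  "hyperbolic_frame e z z' s Y \<longleftrightarrow> z \<cdot> z = e \<and> z' \<cdot> z' = - e \<and> orthonormal e Y \<and>
     orthogonal_system ({z, z', s} \<union> Y) \<and>
     card ({z, z', s} \<union> Y) + 2 = CARD('n) \<and> card Y + 5 = CARD('n)"

lemma hyperbolic_frameD: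
  assumes "hyperbolic_frame e z z' s Y"
  shows "z \<notin> Y" "Y \<subseteq> perp \<sigma> {z, z'}" "orthonormal e (insert z Y)"
proof -
  have disjoint: "{z, z'} \<inter> Y = {}"
    using assms by (auto simp: hyperbolic_frame_def card_insert_if split: if_splits)
  then show "z \<notin> Y" by blast
  have "orthogonal_system ({z, z'} \<union> Y)"
    using assms by (auto simp: hyperbolic_frame_def intro: orthogonal_system_subset)
  then show Y_perp: "Y \<subseteq> perp \<sigma> {z, z'}"
    using disjoint by (rule subset_perp_if_orthogonal_system_Un)
  then have "z \<in> perp \<sigma> Y" using subset_perp_commute[of Y] by simp
  then show "orthonormal e (insert z Y)"
    using assms by (simp add: hyperbolic_frame_def orthonormal_insert)
qed

lemma hyperbolic_frame_exists:
  assumes dim: "7 \<le> CARD('n)" and "e \<noteq> 0" "c \<noteq> 0" "c \<noteq> 1"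
    and orth: "orthogonal_system ({z, z'} \<union> {v, v'})" and card: "card ({z, z'} \<union> {v, v'}) = 4"
    and norms: "z \<cdot> z = e" "z' \<cdot> z' = - e" "v' \<cdot> v' = e"
  obtains s Y w where "hyperbolic_frame e z z' s Y" "{v, w} \<subseteq> perp \<sigma> ({z, z', s} \<union> Y)"
    "w \<cdot> v = 0" "w \<cdot> w = c * e" "w \<cdot> v' = c * e" "v' - w \<in> vec.span Y"
proof -
  define X where "X = {z, z', v}"
  have X_v': "{z, z'} \<union> {v, v'} = X \<union> {v'}" by (auto simp: X_def)
  have "card X = 3" "X \<inter> {v'} = {}"
    using card by (auto simp: X_def card_insert_if split: if_splits)
  have "orthogonal_system X"
    using orth by (rule orthogonal_system_subset) (auto simp: X_def)
  moreover have "v' \<in> perp \<sigma> X"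
    using subset_perp_if_orthogonal_system_Un[OF _ \<open>X \<inter> {v'} = {}\<close>] orth unfolding X_v' by blast
  moreover have "card X + (CARD('n) - 5) + 2 = CARD('n)" "2 \<le> CARD('n) - 5"
    using \<open>card X = 3\<close> dim by simp_all
  ultimately obtain w s Y where w: "w \<cdot> w = c * e" "w \<cdot> v' = c * e" "v' - w \<in> vec.span Y"
    and Y: "orthonormal e Y" "card Y = CARD('n) - 5"
    and basis: "orthogonal_system (X \<union> {w, s} \<union> Y)" "card (X \<union> {w, s} \<union> Y) = CARD('n)"
    using prescribed_component_basis[of X v' c e "CARD('n) - 5"] norms(3) assms(2-4) by metis
  let ?R = "{z, z', s} \<union> Y"
  have basis_eq: "X \<union> {w, s} \<union> Y = ?R \<union> {v, w}" by (auto simp: X_def)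
  have "card ?R + card {v, w} = CARD('n) + card (?R \<inter> {v, w})"
    using card_Un_Int[of ?R "{v, w}"] basis(2) unfolding basis_eq by simp
  moreover have "card ?R \<le> card {z, z', s} + card Y" by (rule card_Un_le)
  moreover have "card {z, z', s} \<le> 3" "card {v, w} \<le> 2" by (simp_all add: card_insert_if)
  moreover note Y(2) dim
  ultimately have card_R: "card ?R + 2 = CARD('n)" and "card {v, w} = 2" "card (?R \<inter> {v, w}) = 0"
    by linarith+
  then have "v \<noteq> w" "?R \<inter> {v, w} = {}" by (auto simp: card_insert_if)
  have vw_perp: "{v, w} \<subseteq> perp \<sigma> ?R"
    using basis(1) \<open>?R \<inter> {v, w} = {}\<close> unfolding basis_eq
    by (rule subset_perp_if_orthogonal_system_Un)
  show thesis
  proof (rule that[OF _ vw_perp])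
    show "hyperbolic_frame e z z' s Y"
      using norms(1,2) card_R Y dim orthogonal_system_subset[OF basis(1), of ?R]
      by (auto simp: hyperbolic_frame_def X_def)
    have "orthogonal_system {v, w}"
      using basis(1) unfolding basis_eq by (rule orthogonal_system_subset) blast
    then show "w \<cdot> v = 0"
      using \<open>v \<noteq> w\<close> by (auto simp: orthogonal_system_def pairwise_insert)
  qed fact+
qed

lemma card_perp_level_frame:
  assumes frame: "hyperbolic_frame e z z' s Y" and "e \<noteq> 0"
    and f: "f \<in> perp \<sigma> ({z, z', s} \<union> Y)" "f \<cdot> f \<noteq> 0"
    and g: "g \<in> perp \<sigma> ({z, z', s} \<union> Y)" "g \<cdot> g = e * \<alpha>" "\<alpha> \<noteq> 0"
    and "f \<cdot> g = 0"
  shows "card {u \<in> perp_level e (insert z Y). u \<cdot> z' \<noteq> 0 \<and> u \<cdot> f = 0}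
    = quadric_count \<alpha> (s \<cdot> s / e)"
proof -
  let ?R = "{z, z', s} \<union> Y" and ?F = "insert f (insert z Y)"
  have R: "z' \<cdot> z' = - e" "orthogonal_system ?R" "card ?R + 2 = CARD('n)" "card Y + 5 = CARD('n)"
    using frame by (simp_all add: hyperbolic_frame_def)
  have basis_eq: "?F \<union> {z', g, s} = insert f (insert g ?R)" by auto
  have "g \<cdot> g \<noteq> 0" using g(2,3) \<open>e \<noteq> 0\<close> by simp
  then have orth_g: "orthogonal_system (insert g ?R)" and "g \<notin> ?R"
    using orthogonal_system_insert nonsingular_perp_notin R(2) g(1) by blast+
  have f_perp: "f \<in> perp \<sigma> (insert g ?R)" using f(1) \<open>f \<cdot> g = 0\<close> by (simp add: mem_perp_iff)
  then have "f \<notin> insert g ?R" using f(2) by (rule nonsingular_perp_notin)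
  have "card {u \<in> perp_level e ?F. u \<cdot> z' \<noteq> 0} = quadric_count \<alpha> (s \<cdot> s / e)"
  proof (rule card_perp_level_off_hyperplane)
    show "orthogonal_system (?F \<union> {z', g, s})"
      unfolding basis_eq using orth_g f_perp f(2) by (rule orthogonal_system_insert)
    show "card (?F \<union> {z', g, s}) = CARD('n)"
      unfolding basis_eq using \<open>f \<notin> _\<close> \<open>g \<notin> ?R\<close> R(3) by simp
    have "z \<notin> Y" by (rule hyperbolic_frameD[OF frame])
    moreover have "f \<notin> insert z Y" using \<open>f \<notin> _\<close> by blast
    ultimately show "card ?F + 3 = CARD('n)" using R(4) by simp
  qed (use R(1) g(2) \<open>e \<noteq> 0\<close> in simp_all)
  moreover have "{u \<in> perp_level e ?F. u \<cdot> z' \<noteq> 0}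
      = {u \<in> perp_level e (insert z Y). u \<cdot> z' \<noteq> 0 \<and> u \<cdot> f = 0}"
    by (auto simp: perp_level_def mem_perp_iff)
  ultimately show ?thesis by simp
qed

lemma card_perp_level_frame_neq:
  assumes frame: "hyperbolic_frame e z z' s Y" and "e \<noteq> 0"
    and perp_frame: "{v, w} \<subseteq> perp \<sigma> ({z, z', s} \<union> Y)"
    and products: "v \<cdot> v = e" "w \<cdot> v = 0" "w \<cdot> w = c * e"
    and "c \<noteq> 0" and nonsquare: "\<not> is_square (a\<^sup>2 + r\<^sup>2 * c)"
  shows "card {u \<in> perp_level e (insert z Y). u \<cdot> z' \<noteq> 0 \<and> u \<cdot> (a *s v + r *s w) = 0}
    \<noteq> card {u \<in> perp_level e (insert z Y). u \<cdot> z' \<noteq> 0 \<and> u \<cdot> v = 0}"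
proof -
  define count where
    "count x = card {u \<in> perp_level e (insert z Y). u \<cdot> z' \<noteq> 0 \<and> u \<cdot> x = 0}" for x
  define g where "g = a\<^sup>2 + r\<^sup>2 * c"
  define f where "f = a *s v + r *s w"
  define h where "h = (r * c) *s v - a *s w"
  have "v \<cdot> w = 0" using products(2) by (simp add: bilin_commute)
  have "\<not> is_square g" using nonsquare by (simp add: g_def)
  then have "g \<noteq> 0" by auto
  have "f \<cdot> f = e * g" "h \<cdot> h = e * (c * g)" "f \<cdot> h = 0"
    using products \<open>v \<cdot> w = 0\<close>
    by (simp_all add: f_def g_def h_def power2_eq_square algebra_simps)
  moreover have "f \<in> perp \<sigma> ({z, z', s} \<union> Y)" "h \<in> perp \<sigma> ({z, z', s} \<union> Y)"
    unfolding f_def h_def using perp_frame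
    by (intro vec.subspace_add vec.subspace_diff vec.subspace_scale subspace_perp; simp)+
  ultimately have "count f = quadric_count (c * g) (s \<cdot> s / e)"
    unfolding count_def using \<open>e \<noteq> 0\<close> \<open>g \<noteq> 0\<close> \<open>c \<noteq> 0\<close>
    by (intro card_perp_level_frame[OF frame \<open>e \<noteq> 0\<close>]) simp_all
  moreover have "count v = quadric_count c (s \<cdot> s / e)"
    unfolding count_def using perp_frame products \<open>v \<cdot> w = 0\<close> \<open>e \<noteq> 0\<close> \<open>c \<noteq> 0\<close>
    by (intro card_perp_level_frame[OF frame \<open>e \<noteq> 0\<close>, of v w]) simp_all
  moreover have "s \<cdot> s / e \<noteq> 0"
    using frame \<open>e \<noteq> 0\<close> by (simp add: hyperbolic_frame_def orthogonal_system_def)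
  ultimately have "count f \<noteq> count v"
    using quadric_count_mult_nonsquare_neq[OF two_neq_0 \<open>c \<noteq> 0\<close> _ \<open>\<not> is_square g\<close>] by simp
  then show ?thesis by (simp only: count_def f_def not_False_eq_True)
qed

end

locale framed_switching_pair = switching_pair \<sigma> \<epsilon> e p v\<^sub>1 v\<^sub>2
  for \<sigma> :: "'a::{field,finite} ^ 'n \<Rightarrow> 'a" and \<epsilon> e p v\<^sub>1 v\<^sub>2 +
  fixes a r c :: 'a and v' z z' s w :: "'a ^ 'n" and Y :: "('a ^ 'n) set"
  assumes p_eq: "p = point (z + z')"
    and v\<^sub>1_eq: "v\<^sub>1 = a *s v\<^sub>2 + r *s v'" and r_nonzero: "r \<noteq> 0"
    and v': "v' \<cdot> v' = e" "z \<cdot> v' = 0"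
    and c_neq: "c \<noteq> 0" "c \<noteq> 1" and nonsquare: "\<not> is_square (a\<^sup>2 + r\<^sup>2 * c)"
    and frame: "hyperbolic_frame e z z' s Y"
    and perp_frame: "{v\<^sub>2, w} \<subseteq> perp \<sigma> ({z, z', s} \<union> Y)"
    and w: "w \<cdot> v\<^sub>2 = 0" "w \<cdot> w = c * e" "w \<cdot> v' = c * e" "v' - w \<in> vec.span Y"
begin

lemma mem_perp_p_iff: "u \<in> perp \<sigma> p \<longleftrightarrow> u \<cdot> z + u \<cdot> z' = 0"
  by (simp add: p_eq point_def perp_span mem_perp_iff)

lemma frame_perp:
  assumes "k \<in> {z, z', s} \<union> Y"
  shows "k \<cdot> v\<^sub>2 = 0" "k \<cdot> w = 0" "w \<cdot> k = 0"
  using perp_frame perpD assms by blast+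

lemma bilin_v\<^sub>1:
  assumes "u \<in> perp \<sigma> Y"
  shows "u \<cdot> v\<^sub>1 = u \<cdot> (a *s v\<^sub>2 + r *s w)"
proof -
  have "u \<cdot> (v' - w) = 0"
    using assms w(4) perpD(1) unfolding perp_span[symmetric, of Y] by blast
  then show ?thesis by (simp add: v\<^sub>1_eq)
qed

lemma card_not_perp_v\<^sub>1_neq_v\<^sub>2:
  "card {u \<in> perp_level e (insert z Y). u \<notin> perp \<sigma> p \<and> u \<cdot> v\<^sub>1 = 0}
    \<noteq> card {u \<in> perp_level e (insert z Y). u \<notin> perp \<sigma> p \<and> u \<cdot> v\<^sub>2 = 0}"
proof -
  have level: "u \<in> perp \<sigma> p \<longleftrightarrow> u \<cdot> z' = 0" "u \<cdot> v\<^sub>1 = u \<cdot> (a *s v\<^sub>2 + r *s w)"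
    if "u \<in> perp_level e (insert z Y)" for u
    using that bilin_v\<^sub>1[of u] by (simp_all add: perp_level_def mem_perp_p_iff mem_perp_iff[of u])
  have "{u \<in> perp_level e (insert z Y). u \<notin> perp \<sigma> p \<and> u \<cdot> v\<^sub>1 = 0}
      = {u \<in> perp_level e (insert z Y). u \<cdot> z' \<noteq> 0 \<and> u \<cdot> (a *s v\<^sub>2 + r *s w) = 0}"
    "{u \<in> perp_level e (insert z Y). u \<notin> perp \<sigma> p \<and> u \<cdot> v\<^sub>2 = 0}
      = {u \<in> perp_level e (insert z Y). u \<cdot> z' \<noteq> 0 \<and> u \<cdot> v\<^sub>2 = 0}"
    using level by auto
  then show ?thesis
    using card_perp_level_frame_neq[OF frame e_nonzero perp_frame tangent_vectors(2) w(1,2)]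
      c_neq(1) nonsquare
    by (simp only: not_False_eq_True)
qed

lemma exists_Y_not_perp_v\<^sub>1: "\<exists>y\<in>Y. y \<cdot> v\<^sub>1 \<noteq> 0"
proof (rule ccontr)
  assume "\<not> (\<exists>y\<in>Y. y \<cdot> v\<^sub>1 \<noteq> 0)"
  then have "y \<cdot> v' = 0" if "y \<in> Y" for y
    using that frame_perp(1)[of y] v\<^sub>1_eq r_nonzero by auto
  then have "Y \<subseteq> perp \<sigma> {v', w}" using frame_perp(2) by (simp add: mem_perp_iff subset_eq)
  then have "{v', w} \<subseteq> perp \<sigma> (vec.span Y)"
    using subset_perp_commute[of Y "{v', w}"] by (simp add: perp_span)
  then have "v' \<cdot> (v' - w) = 0" "w \<cdot> (v' - w) = 0"
    using w(4) perpD(1) by blast+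
  then have "(1 - c) * e = 0"
    using v'(1) w(2,3) by (simp add: bilin_commute[of v' w] algebra_simps)
  with c_neq(2) e_nonzero show False by simp
qed

lemma frame_points_notin_C\<^sub>1:
  assumes "k \<in> insert z Y"
  shows "point k \<notin> C\<^sub>1"
proof
  assume "point k \<in> C\<^sub>1"
  moreover have "k \<cdot> k = e"
    using assms hyperbolic_frameD(3)[OF frame] by (auto simp: orthonormal_def)
  moreover have "w \<in> perp \<sigma> p" using frame_perp(3) by (simp add: mem_perp_p_iff)
  ultimately have "k \<cdot> w = 0 \<longleftrightarrow> v\<^sub>1 \<cdot> w = 0"
    using tangent_point_bilin_eq_0_iff tangent(1) by blast
  moreover have "v\<^sub>1 \<cdot> w = r * (c * e)"
    using w(1,3) by (simp add: v\<^sub>1_eq bilin_commute[of v\<^sub>2] bilin_commute[of v'])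
  ultimately show False using frame_perp(2)[of k] assms r_nonzero c_neq(1) e_nonzero by auto
qed

lemma switching_clique_frame:
  obtains y where "switching_clique \<sigma> \<epsilon> e p v\<^sub>1 v\<^sub>2 (insert z Y) y"
proof -
  have Y_perp: "y \<in> perp \<sigma> p" if "y \<in> Y" for y
    using hyperbolic_frameD(2)[OF frame] that perpD(1)[of y "{z, z'}"]
    unfolding mem_perp_p_iff by auto
  obtain y where y: "y \<in> Y" "y \<cdot> v\<^sub>1 \<noteq> 0" using exists_Y_not_perp_v\<^sub>1 by blast
  have "switching_clique \<sigma> \<epsilon> e p v\<^sub>1 v\<^sub>2 (insert z Y) y"
  proof
    show "orthonormal e (insert z Y)" by (rule hyperbolic_frameD[OF frame])
    show "k \<cdot> v\<^sub>2 = 0" "point k \<notin> C\<^sub>1" if "k \<in> insert z Y" for k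
      using that frame_perp(1)[of k] frame_points_notin_C\<^sub>1 by blast+
    show "k \<cdot> v\<^sub>1 = 0" if "k \<in> insert z Y" "k \<notin> perp \<sigma> p" for k
      using that Y_perp v'(2) frame_perp(1)[of z] by (auto simp: v\<^sub>1_eq)
    show "y \<in> insert z Y" "y \<in> perp \<sigma> p" "y \<cdot> v\<^sub>1 \<noteq> 0" using y Y_perp by simp_all
  qed
  then show thesis by (rule that)
qed

lemma not_graph_iso_switch_frame: "\<not> graph_iso \<Gamma>' \<Gamma>"
proof -
  obtain y where "switching_clique \<sigma> \<epsilon> e p v\<^sub>1 v\<^sub>2 (insert z Y) y" by (rule switching_clique_frame)
  then show ?thesis using card_not_perp_v\<^sub>1_neq_v\<^sub>2 by (rule switching_clique.not_graph_iso_switch)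
qed

end

subsection \<open>The form induced on the quotient\<close>

lemma coset_eq_subspace_iff:
  assumes "vec.subspace p"
  shows "v +o p = p \<longleftrightarrow> v \<in> p"
proof
  assume "v +o p = p"
  then show "v \<in> p" using set_plus_intro2[OF vec.subspace_0[OF assms], of v] by simp
next
  assume "v \<in> p"
  have "u - v \<in> p \<longleftrightarrow> u \<in> p" for u
    using vec.subspace_diff[OF assms _ \<open>v \<in> p\<close>, of u]
      vec.subspace_add[OF assms _ \<open>v \<in> p\<close>, of "u - v"] by auto
  then show "v +o p = p" unfolding set_minus_plus by blast
qed

lemma quotient_isometricE:
  assumes "quotient_isometric \<sigma> P p \<tau>"
    and subspace_P: "vec.subspace P" and subspace_p: "vec.subspace p"
  obtains \<psi> where "\<psi> ` P = UNIV"
    and "\<And>u v. u \<in> P \<Longrightarrow> v \<in> P \<Longrightarrow> \<psi> (u + v) = \<psi> u + \<psi> v"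
    and "\<And>v. v \<in> P \<Longrightarrow> \<psi> v = 0 \<longleftrightarrow> v \<in> p"
    and "\<And>v. v \<in> P \<Longrightarrow> \<tau> (\<psi> v) = \<sigma> v"
proof -
  obtain \<phi> where bij: "bij_betw \<phi> ((\<lambda>v. v +o p) ` P) UNIV"
    and add: "\<And>u v. u \<in> P \<Longrightarrow> v \<in> P \<Longrightarrow> \<phi> ((u + v) +o p) = \<phi> (u +o p) + \<phi> (v +o p)"
    and scale: "\<And>c v. v \<in> P \<Longrightarrow> \<phi> ((c *s v) +o p) = c *s \<phi> (v +o p)"
    and form: "\<And>v. v \<in> P \<Longrightarrow> \<tau> (\<phi> (v +o p)) = \<sigma> v"
    using assms(1) unfolding quotient_isometric_def by blast
  have zero: "0 \<in> P" "\<phi> (0 +o p) = 0"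
    using vec.subspace_0[OF subspace_P] scale[of 0 0] by simp_all
  show thesis
  proof (rule that[of "\<lambda>v. \<phi> (v +o p)"])
    show "(\<lambda>v. \<phi> (v +o p)) ` P = UNIV"
      using bij by (simp add: bij_betw_def image_image)
    show "\<phi> (v +o p) = 0 \<longleftrightarrow> v \<in> p" if "v \<in> P" for v
    proof -
      have "v +o p \<in> (\<lambda>v. v +o p) ` P" "0 +o p \<in> (\<lambda>v. v +o p) ` P"
        using that zero(1) by blast+
      from inj_on_eq_iff[OF bij_betw_imp_inj_on[OF bij] this]
      have "\<phi> (v +o p) = 0 \<longleftrightarrow> v +o p = 0 +o p" by (simp only: zero(2))
      then show ?thesis using coset_eq_subspace_iff[OF subspace_p] by simp
    qed
  qed (fact add, fact form)
qed

lemma quotient_isometric_radical: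
  assumes isometric: "quotient_isometric \<sigma> P p \<tau>"
    and subspace_P: "vec.subspace P" and subspace_p: "vec.subspace p"
    and nondegenerate: "nondegenerate \<tau>"
  shows "P \<inter> perp \<sigma> P \<subseteq> p"
proof
  fix x assume radical: "x \<in> P \<inter> perp \<sigma> P"
  obtain \<psi> where \<psi>: "\<psi> ` P = UNIV" "\<And>u v. u \<in> P \<Longrightarrow> v \<in> P \<Longrightarrow> \<psi> (u + v) = \<psi> u + \<psi> v"
    "\<And>v. v \<in> P \<Longrightarrow> \<psi> v = 0 \<longleftrightarrow> v \<in> p" "\<And>v. v \<in> P \<Longrightarrow> \<tau> (\<psi> v) = \<sigma> v"
    using quotient_isometricE[OF isometric subspace_P subspace_p] by blast
  have "polar \<tau> (\<psi> x) y = 0" for y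
  proof -
    have "y \<in> \<psi> ` P" using \<psi>(1) by simp
    then obtain v where v: "v \<in> P" "y = \<psi> v" by blast
    have "polar \<tau> (\<psi> x) y = polar \<sigma> x v"
      using radical v(1) vec.subspace_add[OF subspace_P]
      by (simp add: polar_def v(2) \<psi>(4) flip: \<psi>(2))
    then show ?thesis using radical v(1) by (simp add: perp_def)
  qed
  then have "\<psi> x \<in> perp \<tau> UNIV" by (simp add: perp_def)
  then show "x \<in> p" using nondegenerate radical \<psi>(3) by (simp add: nondegenerate_def)
qed

lemma quotient_isometric_singular_iff:
  assumes "quotient_isometric \<sigma> P p \<tau>" "vec.subspace P" "vec.subspace p"
  shows "(\<exists>y. y \<noteq> 0 \<and> \<tau> y = 0) \<longleftrightarrow> (\<exists>x\<in>P - p. \<sigma> x = 0)"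
proof -
  obtain \<psi> where \<psi>: "\<psi> ` P = UNIV" "\<And>v. v \<in> P \<Longrightarrow> \<psi> v = 0 \<longleftrightarrow> v \<in> p"
    "\<And>v. v \<in> P \<Longrightarrow> \<tau> (\<psi> v) = \<sigma> v"
    using quotient_isometricE[OF assms] by metis
  have "(\<exists>y. y \<noteq> 0 \<and> \<tau> y = 0) \<longleftrightarrow> (\<exists>x\<in>P. \<psi> x \<noteq> 0 \<and> \<tau> (\<psi> x) = 0)"
    using \<psi>(1) by (metis UNIV_I imageE)
  then show ?thesis using \<psi>(2,3) by auto
qed

context switching_pair
begin

abbreviation P :: "('a ^ 'n) set" where "P \<equiv> vec.span (insert v\<^sub>1 (insert v\<^sub>2 p))"

lemma mem_PE:
  assumes "x \<in> P"
  obtains c d w where "w \<in> p" "x = c *s v\<^sub>1 + d *s v\<^sub>2 + w"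
proof -
  obtain c d where "x - c *s v\<^sub>1 - d *s v\<^sub>2 \<in> p"
    using assms subspace_p by (auto simp: vec.span_insert vec.span_eq_iff[THEN iffD2])
  then show thesis by (rule that[of _ c d]) simp
qed

lemma combination_mem_P: "c *s v\<^sub>1 + d *s v\<^sub>2 \<in> P"
  by (intro vec.span_add vec.span_scale vec.span_base) simp_all

lemma bilin_combination:
  assumes mem_p: "w \<in> p" "w' \<in> p" and product: "v\<^sub>1 \<cdot> v\<^sub>2 = e * a"
  shows "(c *s v\<^sub>1 + d *s v\<^sub>2 + w) \<cdot> (c' *s v\<^sub>1 + d' *s v\<^sub>2 + w')
    = e * ((d + a * c) * (d' + a * c') + (1 - a\<^sup>2) * c * c')"
proof -
  have "v\<^sub>2 \<cdot> v\<^sub>1 = e * a" using product by (simp add: bilin_commute)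
  moreover have "w \<cdot> w' = 0" using mem_p p_subset_perp by (blast dest: perpD)
  moreover have "v \<cdot> x = 0" "x \<cdot> v = 0" if "v \<in> {v\<^sub>1, v\<^sub>2}" "x \<in> {w, w'}" for v x
    using that mem_p perpD[of v p x] tangent_vectors(3,4) by auto
  ultimately show ?thesis
    using tangent_vectors(1,2) product by (simp add: algebra_simps power2_eq_square)
qed

lemma power2_neq_1_if_radical_subset:
  assumes radical: "P \<inter> perp \<sigma> P \<subseteq> p" and product: "v\<^sub>1 \<cdot> v\<^sub>2 = e * a"
  shows "a\<^sup>2 \<noteq> 1"
proof
  assume "a\<^sup>2 = 1"
  let ?x = "1 *s v\<^sub>1 + (- a) *s v\<^sub>2"
  have "?x \<cdot> y = 0" if "y \<in> P" for y
  proof -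
    obtain c d w where "w \<in> p" "y = c *s v\<^sub>1 + d *s v\<^sub>2 + w" using \<open>y \<in> P\<close> by (rule mem_PE)
    then show ?thesis
      using bilin_combination[OF zero_mem_p _ product, of w 1 "- a" c d] \<open>a\<^sup>2 = 1\<close> by simp
  qed
  then have "?x \<in> P \<inter> perp \<sigma> P" using combination_mem_P[of 1 "- a"] by (simp add: mem_perp_iff)
  then have "?x \<in> p" using radical by blast
  then show False using independent[of 1 "- a"] by simp
qed

lemma singular_quotient_iff:
  assumes product: "v\<^sub>1 \<cdot> v\<^sub>2 = e * a"
  shows "(\<exists>x\<in>P - p. \<sigma> x = 0) \<longleftrightarrow> is_square (a\<^sup>2 - 1)"
proof
  assume "\<exists>x\<in>P - p. \<sigma> x = 0"
  then obtain x where x: "x \<in> P" "x \<notin> p" "x \<cdot> x = 0" by (auto simp: bilin_self)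
  obtain c d w where w: "w \<in> p" "x = c *s v\<^sub>1 + d *s v\<^sub>2 + w" using x(1) by (rule mem_PE)
  have "(d + a * c)\<^sup>2 + (1 - a\<^sup>2) * c\<^sup>2 = 0"
    using bilin_combination[OF w(1) w(1) product, of c d c d] x(3) e_nonzero
    unfolding w(2) by (simp add: power2_eq_square mult_ac)
  then have discriminant: "(a\<^sup>2 - 1) * c\<^sup>2 = (d + a * c)\<^sup>2" by (simp add: algebra_simps)
  have "c \<noteq> 0"
  proof
    assume "c = 0"
    then have "d = 0" using discriminant by simp
    with \<open>c = 0\<close> w x(2) show False by simp
  qed
  then have "a\<^sup>2 - 1 = ((d + a * c) / c)\<^sup>2"
    using discriminant by (simp add: power_divide field_simps)
  then show "is_square (a\<^sup>2 - 1)" by (rule is_nth_powerI)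
next
  assume "is_square (a\<^sup>2 - 1)"
  then obtain k where root: "a\<^sup>2 - 1 = k\<^sup>2" by (rule is_nth_powerE)
  let ?x = "1 *s v\<^sub>1 + (k - a) *s v\<^sub>2"
  have "?x \<cdot> ?x = e * (k\<^sup>2 + (1 - a\<^sup>2))"
    using bilin_combination[OF zero_mem_p zero_mem_p product, of 1 "k - a" 1 "k - a"]
    by (simp add: power2_eq_square)
  then have "\<sigma> ?x = 0" using root by (simp add: bilin_self algebra_simps)
  moreover have "?x \<notin> p" using independent[of 1 "k - a"] by auto
  ultimately show "\<exists>x\<in>P - p. \<sigma> x = 0" using combination_mem_P by blast
qed

lemma quotient_discriminant:
  assumes \<tau>: "type_O2 (if CARD('a) mod 4 = 3 then Neg else Pos) \<tau>" "quotient_isometric \<sigma> P p \<tau>"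
    and odd: "odd CARD('a)" and product: "v\<^sub>1 \<cdot> v\<^sub>2 = e * a"
  obtains r where "r \<noteq> 0" "a\<^sup>2 + r\<^sup>2 = 1"
proof -
  have "nondegenerate \<tau>" using \<tau>(1) by (simp add: type_O2_def)
  then have "P \<inter> perp \<sigma> P \<subseteq> p"
    using \<tau>(2) subspace_p by (intro quotient_isometric_radical) simp_all
  then have "a\<^sup>2 \<noteq> 1" using product by (rule power2_neq_1_if_radical_subset)
  have "(\<exists>y. y \<noteq> 0 \<and> \<tau> y = 0) \<longleftrightarrow> CARD('a) mod 4 \<noteq> 3"
    using \<tau>(1) by (auto simp: type_O2_def split: if_splits)
  also have "\<dots> \<longleftrightarrow> is_square (- 1 :: 'a)"
    unfolding is_square_minus_1_iff[OF two_neq_0] using odd by presburger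
  finally have "is_square (- 1 :: 'a) \<longleftrightarrow> is_square (a\<^sup>2 - 1)"
    using quotient_isometric_singular_iff[OF \<tau>(2)] singular_quotient_iff[OF product] subspace_p
    by simp
  then have "is_square ((- 1) * (a\<^sup>2 - 1))"
    using is_square_mult_iff[OF two_neq_0, of "- 1" "a\<^sup>2 - 1"] \<open>a\<^sup>2 \<noteq> 1\<close> by simp
  then obtain r where "(- 1) * (a\<^sup>2 - 1) = r\<^sup>2" by (rule is_nth_powerE)
  with \<open>a\<^sup>2 \<noteq> 1\<close> show thesis by (intro that[of r]) (auto simp: algebra_simps)
qed

lemma v\<^sub>1_decomposition:
  assumes product: "v\<^sub>1 \<cdot> v\<^sub>2 = e * a" and "r \<noteq> 0" and circle: "a\<^sup>2 + r\<^sup>2 = 1"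
  obtains v' where "v\<^sub>1 = a *s v\<^sub>2 + r *s v'" "v' \<cdot> v' = e" "v\<^sub>2 \<cdot> v' = 0" "v' \<in> perp \<sigma> p"
proof -
  define v' where "v' = (1 / r) *s (v\<^sub>1 - a *s v\<^sub>2)"
  have v\<^sub>1_eq: "v\<^sub>1 = a *s v\<^sub>2 + r *s v'" using \<open>r \<noteq> 0\<close> by (simp add: v'_def)
  have v\<^sub>2_v': "v\<^sub>2 \<cdot> v' = 0"
    using product tangent_vectors(2) by (simp add: v'_def bilin_commute[of v\<^sub>2 v\<^sub>1])
  have "v\<^sub>1 \<cdot> v\<^sub>1 = a\<^sup>2 * e + r\<^sup>2 * (v' \<cdot> v')"
    using v\<^sub>2_v' tangent_vectors(2)
    by (simp add: v\<^sub>1_eq bilin_commute[of v' v\<^sub>2] power2_eq_square mult.assoc)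
  then have "r\<^sup>2 * (v' \<cdot> v') = (1 - a\<^sup>2) * e"
    using tangent_vectors(1) by (simp add: algebra_simps)
  also have "1 - a\<^sup>2 = r\<^sup>2" using circle by (simp add: algebra_simps)
  finally have "v' \<cdot> v' = e" using \<open>r \<noteq> 0\<close> by simp
  moreover have "v' \<in> perp \<sigma> p"
    unfolding v'_def using tangent_vectors(3,4)
    by (intro vec.subspace_scale vec.subspace_diff subspace_perp)
  ultimately show thesis using that v\<^sub>1_eq v\<^sub>2_v' by blast
qed

theorem not_graph_iso_switch_if_type_O2:
  assumes dim: "7 \<le> CARD('n)" "vec.dim p = 1" and odd: "odd CARD('a)"
    and \<tau>: "type_O2 (if CARD('a) mod 4 = 3 then Neg else Pos) \<tau>" "quotient_isometric \<sigma> P p \<tau>"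
  shows "\<not> graph_iso \<Gamma>' \<Gamma>"
proof -
  define a where "a = v\<^sub>1 \<cdot> v\<^sub>2 / e"
  have product: "v\<^sub>1 \<cdot> v\<^sub>2 = e * a" using e_nonzero by (simp add: a_def)
  obtain r where r: "r \<noteq> 0" "a\<^sup>2 + r\<^sup>2 = 1" using quotient_discriminant[OF \<tau> odd product] .
  obtain c where c: "c \<noteq> 0" "c \<noteq> 1" "\<not> is_square (a\<^sup>2 + r\<^sup>2 * c)"
    using nonsquare_combination[OF two_neq_0 r] .
  obtain v' where v': "v\<^sub>1 = a *s v\<^sub>2 + r *s v'" "v' \<cdot> v' = e" "v\<^sub>2 \<cdot> v' = 0" "v' \<in> perp \<sigma> p"
    using v\<^sub>1_decomposition[OF product r] .
  then have "v' \<cdot> v\<^sub>2 = 0" "v\<^sub>2 \<noteq> v'" using e_nonzero by (auto simp: bilin_commute)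
  then have orth: "orthogonal_system {v\<^sub>2, v'}"
    using v' tangent_vectors(2) e_nonzero by (simp add: orthogonal_system_def pairwise_insert)
  obtain p\<^sub>0 where p\<^sub>0: "p\<^sub>0 \<in> p" "p\<^sub>0 \<noteq> 0" using dim(2) vec.dim_eq_0[of p] by auto
  have p_eq: "p = point p\<^sub>0"
    using subspace_p dim(2) p\<^sub>0 by (intro eq_pointI) (simp_all add: points_def)
  have "p\<^sub>0 \<in> perp \<sigma> {v\<^sub>2, v'}" "p\<^sub>0 \<cdot> p\<^sub>0 = 0"
    using p\<^sub>0(1) tangent_vectors(4) v'(4) p_subset_perp
    by (auto simp: mem_perp_iff[of p\<^sub>0] dest: perpD)
  then obtain z z' where z: "z + z' = p\<^sub>0" "z \<in> perp \<sigma> {v\<^sub>2, v'}"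
      "z \<cdot> z = e" "z' \<cdot> z' = - e" "orthogonal_system ({z, z'} \<union> {v\<^sub>2, v'})"
      "card ({z, z'} \<union> {v\<^sub>2, v'}) = card {v\<^sub>2, v'} + 2"
    using hyperbolic_pair[OF orth] p\<^sub>0(2) e_nonzero by metis
  have "card ({z, z'} \<union> {v\<^sub>2, v'}) = 4" unfolding z(6) using \<open>v\<^sub>2 \<noteq> v'\<close> by simp
  then obtain s Y w where "hyperbolic_frame e z z' s Y" "{v\<^sub>2, w} \<subseteq> perp \<sigma> ({z, z', s} \<union> Y)"
    "w \<cdot> v\<^sub>2 = 0" "w \<cdot> w = c * e" "w \<cdot> v' = c * e" "v' - w \<in> vec.span Y"
    using hyperbolic_frame_exists[OF dim(1) e_nonzero c(1,2) z(5) _ z(3,4) v'(2)] by blast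
  then have "framed_switching_pair \<sigma> \<epsilon> e p v\<^sub>1 v\<^sub>2 a r c v' z z' s w Y"
    using p_eq z(1,2) r(1) c v' by unfold_locales (auto simp: mem_perp_iff[of z])
  then show ?thesis by (rule framed_switching_pair.not_graph_iso_switch_frame)
qed

end

lemma (in quadratic_space) switching_pair_exists:
  assumes L\<^sub>1: "vec.subspace L\<^sub>1" "vec.dim L\<^sub>1 = Suc (vec.dim p)" "p = L\<^sub>1 \<inter> perp \<sigma> L\<^sub>1"
    and L\<^sub>2: "vec.subspace L\<^sub>2" "vec.dim L\<^sub>2 = Suc (vec.dim p)" "p = L\<^sub>2 \<inter> perp \<sigma> L\<^sub>2"
    and p_eq: "p = L\<^sub>1 \<inter> L\<^sub>2"
    and signs: "{x \<in> points. x \<subseteq> L\<^sub>1 \<and> \<not> x \<subseteq> L\<^sub>2} \<union> {x \<in> points. x \<subseteq> L\<^sub>2 \<and> \<not> x \<subseteq> L\<^sub>1}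
      \<subseteq> points_of_sign \<sigma> \<epsilon>" (is "?C \<subseteq> _")
  obtains e v\<^sub>1 v\<^sub>2 where "switching_pair \<sigma> \<epsilon> e p v\<^sub>1 v\<^sub>2"
    "vec.span (insert v\<^sub>1 p) = L\<^sub>1" "vec.span (insert v\<^sub>2 p) = L\<^sub>2" "v\<^sub>1 \<notin> L\<^sub>2" "v\<^sub>2 \<notin> L\<^sub>1"
proof -
  have subspace_p: "vec.subspace p"
    unfolding p_eq using L\<^sub>1(1) L\<^sub>2(1) by (rule vec.subspace_inter)
  have sign: "of_sign \<epsilon> (v \<cdot> v)" if "v \<in> (L\<^sub>1 \<union> L\<^sub>2) - p" for v
  proof -
    have "v \<noteq> 0" using that vec.subspace_0[OF subspace_p] by auto
    then have "point v \<in> ?C"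
      using that p_eq L\<^sub>1(1) L\<^sub>2(1) by (auto simp: point_mem_points point_subset_iff)
    then show ?thesis using signs of_sign_if_point_mem by blast
  qed
  have perp: "x \<in> perp \<sigma> p" if "x \<in> L\<^sub>1 \<union> L\<^sub>2" for x
    using that L\<^sub>1(3) L\<^sub>2(3) perpD(2) unfolding mem_perp_iff[of x] by blast
  have "p \<subseteq> L\<^sub>1" "p \<subseteq> L\<^sub>2" using p_eq by blast+
  moreover have "L\<^sub>1 \<noteq> p" "L\<^sub>2 \<noteq> p" using L\<^sub>1(2) L\<^sub>2(2) by auto
  ultimately obtain u v\<^sub>2 where u: "u \<in> L\<^sub>1" "u \<notin> p" and v\<^sub>2: "v\<^sub>2 \<in> L\<^sub>2" "v\<^sub>2 \<notin> p" by blast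
  obtain t where t: "t \<noteq> 0" "v\<^sub>2 \<cdot> v\<^sub>2 = t\<^sup>2 * (u \<cdot> u)"
    using of_sign_ratio[OF two_neq_0] sign u v\<^sub>2 by (metis Diff_iff UnCI)
  define v\<^sub>1 where "v\<^sub>1 = t *s u"
  have v\<^sub>1: "v\<^sub>1 \<in> L\<^sub>1" "v\<^sub>1 \<notin> p" "v\<^sub>1 \<cdot> v\<^sub>1 = v\<^sub>2 \<cdot> v\<^sub>2"
    using u t L\<^sub>1(1) subspace_p
    by (simp_all add: v\<^sub>1_def subspace_scale_mem_iff power2_eq_square mult.assoc)
  have notin: "v\<^sub>1 \<notin> L\<^sub>2" "v\<^sub>2 \<notin> L\<^sub>1" using v\<^sub>1 v\<^sub>2 p_eq by blast+
  have "isotropic_subspace \<sigma> \<epsilon> (v\<^sub>2 \<cdot> v\<^sub>2) p"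
    using sign v\<^sub>2 subspace_p perp p_eq by unfold_locales (auto simp: totally_isotropic_def)
  then have "switching_pair \<sigma> \<epsilon> (v\<^sub>2 \<cdot> v\<^sub>2) p v\<^sub>1 v\<^sub>2"
    using perp v\<^sub>1 v\<^sub>2(1)
      independent_modulo_intersection[OF L\<^sub>1(1) v\<^sub>1(1) notin(1) L\<^sub>2(1) v\<^sub>2(1) notin(2)]
    by (simp add: switching_pair_def switching_pair_axioms_def isotropic_subspace.tangent_def p_eq)
  moreover have "vec.span (insert v\<^sub>1 p) = L\<^sub>1" "vec.span (insert v\<^sub>2 p) = L\<^sub>2"
    using span_insert_eq_if_dim_eq_Suc[OF subspace_p L\<^sub>1(1) \<open>p \<subseteq> L\<^sub>1\<close> L\<^sub>1(2) v\<^sub>1(1,2)]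
      span_insert_eq_if_dim_eq_Suc[OF subspace_p L\<^sub>2(1) \<open>p \<subseteq> L\<^sub>2\<close> L\<^sub>2(2) v\<^sub>2] by blast+
  ultimately show thesis using that notin by blast
qed

theorem theorem10:
  fixes \<sigma> :: "'a::{field,finite} ^ 'n \<Rightarrow> 'a"
    and q n d m :: nat
    and \<epsilon> \<delta> :: sign
    and L\<^sub>1 L\<^sub>2 p P :: "('a ^ 'n) set"
    and C\<^sub>1 C\<^sub>2 :: "('a ^ 'n) set set"
  assumes q: "q = CARD('a)" "q \<ge> 3" "odd q"
    and n: "n = CARD('n)"
    and d: "d \<ge> 2"
    and type: "type_O_odd d \<sigma> \<or> type_O_plus d \<sigma> \<or> type_O_minus d \<sigma>"
    and m: "3 \<le> m" "m \<le> d"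
    and L\<^sub>1: "vec.subspace L\<^sub>1" "vec.dim L\<^sub>1 = m - 1" "\<not> totally_isotropic \<sigma> L\<^sub>1"
    and L\<^sub>2: "vec.subspace L\<^sub>2" "vec.dim L\<^sub>2 = m - 1" "\<not> totally_isotropic \<sigma> L\<^sub>2"
    and p: "p = L\<^sub>1 \<inter> L\<^sub>2" "vec.dim p = m - 2"
      "p = L\<^sub>1 \<inter> perp \<sigma> L\<^sub>1" "p = L\<^sub>2 \<inter> perp \<sigma> L\<^sub>2"
    and P: "P = L\<^sub>1 + L\<^sub>2"
    and C\<^sub>1: "C\<^sub>1 = {x \<in> points. x \<subseteq> L\<^sub>1 \<and> \<not> x \<subseteq> L\<^sub>2}"
    and C\<^sub>2: "C\<^sub>2 = {x \<in> points. x \<subseteq> L\<^sub>2 \<and> \<not> x \<subseteq> L\<^sub>1}"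
    and C: "C\<^sub>1 \<union> C\<^sub>2 \<subseteq> points_of_sign \<sigma> \<epsilon>"
    and \<delta>: "\<delta> = (if q mod 4 = 3 then Neg else Pos)"
  shows "switching_set (polar_graph \<sigma> \<epsilon>) C\<^sub>1 C\<^sub>2 \<and>
    (m = 3 \<and> (\<exists>\<tau>. type_O2 \<delta> \<tau> \<and> quotient_isometric \<sigma> P p \<tau>) \<and> n \<ge> 7 \<longrightarrow>
      \<not> graph_iso (switch (polar_graph \<sigma> \<epsilon>) C\<^sub>1 C\<^sub>2) (polar_graph \<sigma> \<epsilon>))"
proof -
  have "(2::'a) \<noteq> 0" using q by (simp add: two_neq_0_if_odd_card)
  then interpret quadratic_space \<sigma>
    using type by unfold_locales (auto simp: type_O_odd_def type_O_plus_def type_O_minus_def)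
  have dims: "vec.dim L\<^sub>1 = Suc (vec.dim p)" "vec.dim L\<^sub>2 = Suc (vec.dim p)"
    using L\<^sub>1(2) L\<^sub>2(2) p(2) m by simp_all
  obtain e v\<^sub>1 v\<^sub>2 where pair: "switching_pair \<sigma> \<epsilon> e p v\<^sub>1 v\<^sub>2"
    and L: "vec.span (insert v\<^sub>1 p) = L\<^sub>1" "vec.span (insert v\<^sub>2 p) = L\<^sub>2" "v\<^sub>1 \<notin> L\<^sub>2" "v\<^sub>2 \<notin> L\<^sub>1"
    by (rule switching_pair_exists[OF L\<^sub>1(1) dims(1) p(3) L\<^sub>2(1) dims(2) p(4) p(1)])
      (use C C\<^sub>1 C\<^sub>2 in simp)
  interpret S: switching_pair \<sigma> \<epsilon> e p v\<^sub>1 v\<^sub>2 by (fact pair)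
  have "p \<subseteq> L\<^sub>1" "p \<subseteq> L\<^sub>2" using p(1) by blast+
  then have C_eq: "C\<^sub>1 = S.tangent_points v\<^sub>1" "C\<^sub>2 = S.tangent_points v\<^sub>2"
    using points_span_insert_diff[OF S.subspace_p L\<^sub>2(1) _ L(3)]
      points_span_insert_diff[OF S.subspace_p L\<^sub>1(1) _ L(4)]
    by (simp_all add: C\<^sub>1 C\<^sub>2 L S.tangent_points_def)
  have "insert v\<^sub>1 p \<union> insert v\<^sub>2 p = insert v\<^sub>1 (insert v\<^sub>2 p)" by auto
  then have P_eq: "P = S.P" unfolding P L(1,2)[symmetric] span_set_plus by simp
  show ?thesis
    unfolding C_eq P_eq \<delta> q(1) n
    using S.switching_set_tangent_points S.not_graph_iso_switch_if_type_O2 q p(2) by auto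
qed

end
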